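(* Let $\mathcal{T}$ be a locally finite, vertex-to-vertex parallelogram tiling of the plane $\mathbb{R}^2$ with a finite protoset. Let $\alpha$ denote the minimal interior angle in the prototiles. Then each prototile occurs in only a finite number of orientations in $\mathcal{T}$. Moreover, the number of orientations of each prototile is bounded by a common constant, i.e. there is a constant $N$ such that every prototile of $\mathcal{T}$ occurs in at most $N$ orientations in $\mathcal{T}$.
   Context: A parallelogram tiling is a countable collection $\mathcal{T}=\{T_1,T_2,\ldots\}$ of non-degenerate (nonempty interior) closed parallelograms in $\mathbb{R}^2$, called tiles, with $\bigcup_i T_i=\mathbb{R}^2$ and $\operatorname{int}(T_i)\cap\operatorname{int}(T_j)=\varnothing$ for $i\neq j$. It is locally finite if each ball in $\mathbb{R}^2$ intersects only finitely many tiles. It is vertex-to-vertex if, whenever $x\in\mathbb{R}^2$ is a vertex of some tile $T\in\mathcal{T}$ and $x\in T'\in\mathcal{T}$, then $x$ is a vertex of $T'$. The protoset of $\mathcal{T}$ is the set of congruence classes (under Euclidean isometries, including reflections) of tiles in $\mathcal{T}$; its elements are called prototiles. Two congruent tiles have the same orientation if one is a translate of the other, so the number of orientations in which a prototile occurs is the number of translation classes of tiles of $\mathcal{T}$ in that congruence class. *)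

theory Defs
  imports "HOL-Analysis.Analysis"
begin

definition parallelogram_at :: "real^2 \<Rightarrow> real^2 \<Rightarrow> real^2 \<Rightarrow> (real^2) set" where
  "parallelogram_at p u v =
     {p + s *\<^sub>R u + t *\<^sub>R v | s t. 0 \<le> s \<and> s \<le> 1 \<and> 0 \<le> t \<and> t \<le> 1}"

definition nondegenerate_parallelogram :: "(real^2) set \<Rightarrow> bool" where
  "nondegenerate_parallelogram P \<longleftrightarrow>
     (\<exists>p u v. P = parallelogram_at p u v) \<and> interior P \<noteq> {}"

definition parallelogram_tiling :: "(real^2) set set \<Rightarrow> bool" where
  "parallelogram_tiling \<T> \<longleftrightarrow>
     countable \<T> \<and> (\<forall>P\<in>\<T>. nondegenerate_parallelogram P) \<and> \<Union>\<T> = UNIV \<and>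
     (\<forall>P\<in>\<T>. \<forall>Q\<in>\<T>. P \<noteq> Q \<longrightarrow> interior P \<inter> interior Q = {})"

definition locally_finite_tiling :: "(real^2) set set \<Rightarrow> bool" where
  "locally_finite_tiling \<T> \<longleftrightarrow> (\<forall>x r. finite {P \<in> \<T>. ball x r \<inter> P \<noteq> {}})"

text \<open>The vertices of a parallelogram are its extreme points.\<close>

definition vertex_to_vertex :: "(real^2) set set \<Rightarrow> bool" where
  "vertex_to_vertex \<T> \<longleftrightarrow>
     (\<forall>P\<in>\<T>. \<forall>Q\<in>\<T>. \<forall>x. x extreme_point_of P \<and> x \<in> Q \<longrightarrow> x extreme_point_of Q)"

text \<open>Distance-preserving self-maps of the plane are automatically bijective; reflections are
  included.\<close>

definition congruence_rel :: "((real^2) set \<times> (real^2) set) set" where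
  "congruence_rel =
     {(P, Q). \<exists>f :: real^2 \<Rightarrow> real^2. (\<forall>x y. dist (f x) (f y) = dist x y) \<and> f ` P = Q}"

definition translation_rel :: "((real^2) set \<times> (real^2) set) set" where
  "translation_rel = {(P, Q). \<exists>a. (\<lambda>x. a + x) ` P = Q}"

text \<open>A prototile is a full congruence class of subsets of the plane, so it also contains
  congruent copies that are not tiles; hence the intersection in \<open>orientations\<close>.\<close>

definition protoset :: "(real^2) set set \<Rightarrow> (real^2) set set set" where
  "protoset \<T> = \<T> // congruence_rel"

definition orientations :: "(real^2) set set \<Rightarrow> (real^2) set set \<Rightarrow> (real^2) set set set" where
  "orientations \<T> C = (\<T> \<inter> C) // translation_rel"

text \<open>For nondegenerate \<open>P\<close>, the points \<open>p\<close> with \<open>P = parallelogram_at p u v\<close> for some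
  \<open>u\<close>, \<open>v\<close> are exactly its vertices, and \<open>u\<close>, \<open>v\<close> are then the two edge vectors
  emanating from \<open>p\<close>.\<close>

definition interior_angles :: "(real^2) set \<Rightarrow> real set" where
  "interior_angles P =
     {arccos (u \<bullet> v / (norm u * norm v)) | p u v. P = parallelogram_at p u v}"

definition min_interior_angle :: "(real^2) set set \<Rightarrow> real" where
  "min_interior_angle \<T> = Min (\<Union>C \<in> protoset \<T>. \<Union>P \<in> C. interior_angles P)"

end

theory Submission
  imports Defs
begin

text \<open>
  A worm is the bi-infinite sequence of tiles obtained by crossing parallel copies of one edge
  vector \<open>u\<close>. By vertex-to-vertex it never ends, and as the protoset is finite, its
  midline is a Lipschitz graph in the direction of \<open>u\<close>, so it separates the plane, and two worms
  with nonparallel edges cross at most once, in a common tile. Finiteness of the protoset also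
  means that an edge vector shares a tile with only finitely many others, so it suffices to
  link any two edge vectors of nearly equal direction by boundedly many crossings.

  Let \<open>W\<close>, \<open>W'\<close> be disjoint worms whose edges have nearly the same direction \<open>e\<close>, with \<open>W'\<close>
  to the right of \<open>W\<close>. Only finitely many worms meet a given bounded set, so some worm crossing
  \<open>W\<close> far up enters the region between \<open>W\<close> and \<open>W'\<close> and can leave it only through \<open>W'\<close>.
  If it does not, it is again crossed far up by a worm trapped on its right, and so on. At every
  turn the edge vector rotates clockwise by an amount bounded below while staying in the lower
  half-plane relative to \<open>e\<close>, so after a bounded number of turns \<open>W'\<close> is met.
\<close>

section \<open>Parallelograms\<close>

text \<open>A finite protoset bounds the shapes of the tiles but not their rotations: each edge
  vector has finitely many neighbours under the link relation \<open>related\<close>, yet ever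
  longer chains of links could still produce infinitely many edge vectors. Hence nearby directions
  are connected by chains of one fixed length \<open>N\<close>. If this works for directions at
  distance at most \<open>d\<close>, compactness of the unit circle finishes: finitely many balls of
  radius \<open>d / 2\<close> cover it, and in each of them all edge vectors are reached from a
  single one by \<open>N\<close> finite-to-one links. The uniform length comes from a potential, the
  cosine of the angle between the current edge and the fixed direction \<open>e\<close>. If
  \<epsilon> bounds the sines of all tile angles from below, each clockwise turn inside the lower
  half-plane lowers the cosine by at least \<epsilon>^2 / 2. Its range has length 2, so any k with 2
  < k * \<epsilon>^2 / 2 bounds the number of turns. The determinant \<open>cr\<close> serves two
  purposes: \<open>cr u x\<close> is the height of x over the line spanned by u, scaled by the
  length of u, and its sign tells the two sides of that line apart.\<close>

definition cr :: "real^2 \<Rightarrow> real^2 \<Rightarrow> real" where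
  "cr u v = u $ 1 * v $ 2 - u $ 2 * v $ 1"

lemma cr_simps [simp]:
  "cr (u + v) w = cr u w + cr v w" "cr w (u + v) = cr w u + cr w v"
  "cr (u - v) w = cr u w - cr v w" "cr w (u - v) = cr w u - cr w v"
  "cr (- u) w = - cr u w" "cr w (- u) = - cr w u"
  "cr (a *\<^sub>R u) w = a * cr u w" "cr w (a *\<^sub>R u) = a * cr w u"
  "cr u u = 0" "cr 0 w = 0" "cr w 0 = 0"
  by (simp_all add: cr_def algebra_simps)

lemma cr_swap: "cr v u = - cr u v"
  by (simp add: cr_def)

lemma inner_vec2: "x \<bullet> y = x $ 1 * y $ 1 + x $ 2 * y $ (2::2)" for x y :: "real^2"
  by (simp add: inner_vec_def UNIV_2)

text \<open>Lagrange's identity: \<open>cr\<close> and the inner product are the sine and the cosine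
  of the angle, scaled by the two lengths.\<close>

lemma cr_sq_plus_inner_sq: "(cr u v)\<^sup>2 + (u \<bullet> v)\<^sup>2 = (norm u)\<^sup>2 * (norm v)\<^sup>2"
  unfolding power2_norm_eq_inner by (simp add: inner_vec2 cr_def power2_eq_square algebra_simps)

lemma abs_cr_le: "\<bar>cr u v\<bar> \<le> norm u * norm v"
proof -
  have "(cr u v)\<^sup>2 \<le> (norm u * norm v)\<^sup>2"
    using cr_sq_plus_inner_sq[of u v] zero_le_power2[of "u \<bullet> v"]
    unfolding power_mult_distrib by linarith
  then show ?thesis
    by (simp add: abs_le_square_iff[symmetric])
qed

lemma continuous_on_cr [continuous_intros]:
  "continuous_on S f \<Longrightarrow> continuous_on S g \<Longrightarrow> continuous_on S (\<lambda>x. cr (f x) (g x))"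
  unfolding cr_def by (intro continuous_intros)

text \<open>Cramer's rule with the denominators cleared.\<close>

lemma vec_eq_cr: "cr u v *\<^sub>R x = cr x v *\<^sub>R u + cr u x *\<^sub>R v"
  by (simp add: vec_eq_iff forall_2 cr_def algebra_simps)

lemma vec_eq_cr_cr:
  assumes "cr u v \<noteq> 0"
  shows "x = (cr x v / cr u v) *\<^sub>R u + (cr u x / cr u v) *\<^sub>R v"
proof -
  have "cr u v *\<^sub>R x = cr u v *\<^sub>R ((cr x v / cr u v) *\<^sub>R u + (cr u x / cr u v) *\<^sub>R v)"
    using assms by (simp add: vec_eq_cr[of u v x] scaleR_add_right)
  then show ?thesis using assms by simp
qed

lemma cr_eq_0_parallel:
  assumes "cr u x = 0" "u \<noteq> 0"
  shows "x = (x \<bullet> u / (u \<bullet> u)) *\<^sub>R u"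
proof -
  have "(u \<bullet> u) *\<^sub>R x = (x \<bullet> u) *\<^sub>R u"
    using assms(1)
    by (simp add: vec_eq_iff forall_2 inner_vec2 cr_def algebra_simps)
  then have "(1 / (u \<bullet> u)) *\<^sub>R ((u \<bullet> u) *\<^sub>R x) = (1 / (u \<bullet> u)) *\<^sub>R ((x \<bullet> u) *\<^sub>R u)" by simp
  then show ?thesis using assms(2) by simp
qed

lemma cr_inj:
  assumes "cr u v \<noteq> 0" "a *\<^sub>R u + b *\<^sub>R v = c *\<^sub>R u + d *\<^sub>R v"
  shows "a = c" "b = d"
proof -
  have "cr (a *\<^sub>R u + b *\<^sub>R v) v = cr (c *\<^sub>R u + d *\<^sub>R v) v"
    and "cr u (a *\<^sub>R u + b *\<^sub>R v) = cr u (c *\<^sub>R u + d *\<^sub>R v)" using assms by simp_all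
  then show "a = c" "b = d" using assms(1) by simp_all
qed

section \<open>Coordinates, interior, vertices and representations of a parallelogram\<close>

lemma mem_parallelogram:
  assumes "cr u v \<noteq> 0"
  shows "p + s *\<^sub>R u + t *\<^sub>R v \<in> parallelogram_at p u v \<longleftrightarrow>
    0 \<le> s \<and> s \<le> 1 \<and> 0 \<le> t \<and> t \<le> 1"
proof
  assume "p + s *\<^sub>R u + t *\<^sub>R v \<in> parallelogram_at p u v"
  then obtain a b where "s *\<^sub>R u + t *\<^sub>R v = a *\<^sub>R u + b *\<^sub>R v" "0 \<le> a" "a \<le> 1" "0 \<le> b" "b \<le> 1"
    by (auto simp: parallelogram_at_def add.assoc)
  then show "0 \<le> s \<and> s \<le> 1 \<and> 0 \<le> t \<and> t \<le> 1"
    using cr_inj[OF assms] by metis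
qed (auto simp: parallelogram_at_def)

lemma parallelogram_eq_vimage:
  assumes "cr u v \<noteq> 0"
  shows "parallelogram_at p u v = {x. 0 \<le> cr (x - p) v / cr u v \<and> cr (x - p) v / cr u v \<le> 1 \<and>
    0 \<le> cr u (x - p) / cr u v \<and> cr u (x - p) / cr u v \<le> 1}" (is "_ = ?R")
proof (rule set_eqI)
  fix x
  have "x = p + (cr (x - p) v / cr u v) *\<^sub>R u + (cr u (x - p) / cr u v) *\<^sub>R v"
    using vec_eq_cr_cr[OF assms, of "x - p"] by (simp add: algebra_simps)
  then show "x \<in> parallelogram_at p u v \<longleftrightarrow> x \<in> ?R"
    using mem_parallelogram[OF assms] by (metis (mono_tags, lifting) mem_Collect_eq)
qed

lemma interior_parallelogramI:
  assumes "cr u v \<noteq> 0" "0 < s" "s < 1" "0 < t" "t < 1"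
  shows "p + s *\<^sub>R u + t *\<^sub>R v \<in> interior (parallelogram_at p u v)"
proof (rule interiorI)
  let ?U = "{x. 0 < cr (x - p) v / cr u v} \<inter> {x. cr (x - p) v / cr u v < 1} \<inter>
    {x. 0 < cr u (x - p) / cr u v} \<inter> {x. cr u (x - p) / cr u v < 1}"
  show "open ?U"
    by (intro open_Int open_Collect_less continuous_intros) (use assms in auto)
  show "p + s *\<^sub>R u + t *\<^sub>R v \<in> ?U" using assms by simp
  show "?U \<subseteq> parallelogram_at p u v"
    by (auto simp: parallelogram_eq_vimage[OF assms(1)])
qed

lemma closed_parallelogram:
  assumes "cr u v \<noteq> 0"
  shows "closed (parallelogram_at p u v)"
proof -
  have "parallelogram_at p u v = {x. 0 \<le> cr (x - p) v / cr u v} \<inter> {x. cr (x - p) v / cr u v \<le> 1} \<inter>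
    {x. 0 \<le> cr u (x - p) / cr u v} \<inter> {x. cr u (x - p) / cr u v \<le> 1}"
    by (auto simp: parallelogram_eq_vimage[OF assms(1)])
  then show ?thesis
    by (auto intro!: closed_Int closed_Collect_le continuous_intros simp: assms)
qed

lemma convex_parallelogram: "convex (parallelogram_at p u v)"
proof -
  have *: "parallelogram_at p u v =
    (\<lambda>z. p + z) ` (\<lambda>z. fst z *\<^sub>R u + snd z *\<^sub>R v) ` ({0..1} \<times> {0..1})"
    unfolding parallelogram_at_def by (force simp: image_iff algebra_simps)
  show ?thesis unfolding *
    by (intro convex_translation convex_linear_image convex_Times)
       (auto intro!: linearI simp: algebra_simps)
qed

lemma interior_parallelogram_nonempty_iff:
  "interior (parallelogram_at p u v) \<noteq> {} \<longleftrightarrow> cr u v \<noteq> 0"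
proof
  assume ne: "interior (parallelogram_at p u v) \<noteq> {}"
  show "cr u v \<noteq> 0"
  proof
    assume 0: "cr u v = 0"
    obtain n :: "real^2" where n: "n \<noteq> 0" "n \<bullet> u = 0" "n \<bullet> v = 0"
    proof -
      define J :: "real^2 \<Rightarrow> real^2" where "J z = vector [- z $ 2, z $ 1]" for z
      have J: "J z \<noteq> 0 \<longleftrightarrow> z \<noteq> 0" "J z \<bullet> x = cr z x" for z x
        by (auto simp: J_def vec_eq_iff forall_2 inner_vec2 cr_def vector_2)
      consider "u \<noteq> 0" | "v \<noteq> 0" | "u = 0" "v = 0" by blast
      then show ?thesis
      proof cases
        case 1 then show ?thesis using that[of "J u"] J 0 by simp
      next
        case 2 then show ?thesis using that[of "J v"] J 0 cr_swap[of u v] by simp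
      next
        case 3 then show ?thesis using that[of 1] by simp
      qed
    qed
    have "parallelogram_at p u v \<subseteq> {x. n \<bullet> x = n \<bullet> p}"
      using n by (auto simp: parallelogram_at_def inner_add_right)
    then have "interior (parallelogram_at p u v) \<subseteq> {}"
      using interior_mono interior_hyperplane[OF n(1)] by blast
    then show False using ne by simp
  qed
next
  assume "cr u v \<noteq> 0"
  then show "interior (parallelogram_at p u v) \<noteq> {}"
    using interior_parallelogramI[of u v "1/2" "1/2" p] by auto
qed

lemma parallelogram_swap: "parallelogram_at p v u = parallelogram_at p u v"
  unfolding parallelogram_at_def by (auto simp: algebra_simps) (metis add.commute add.assoc)+

lemma parallelogram_flip: "parallelogram_at (p + v) u (- v) = parallelogram_at p u v"
proof -
  have *: "parallelogram_at (p + v) u (- v) \<subseteq> parallelogram_at p u v" for p v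
  proof
    fix x assume "x \<in> parallelogram_at (p + v) u (- v)"
    then obtain s t where "x = p + v + s *\<^sub>R u + t *\<^sub>R (- v)" "0 \<le> s" "s \<le> 1" "0 \<le> t" "t \<le> 1"
      by (auto simp: parallelogram_at_def)
    then have "x = p + s *\<^sub>R u + (1 - t) *\<^sub>R v" "0 \<le> 1 - t" "1 - t \<le> 1"
      by (auto simp: algebra_simps)
    then show "x \<in> parallelogram_at p u v"
      using \<open>0 \<le> s\<close> \<open>s \<le> 1\<close> unfolding parallelogram_at_def by blast
  qed
  show ?thesis using *[of p v] *[of "p + v" "- v"] by auto
qed

lemma parallelogram_flip': "parallelogram_at (p + u) (- u) v = parallelogram_at p u v"
  using parallelogram_flip[of p u v] by (simp add: parallelogram_swap)

lemma extreme_point_parallelogram: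
  assumes "cr u v \<noteq> 0"
  shows "(p + s *\<^sub>R u + t *\<^sub>R v) extreme_point_of parallelogram_at p u v \<longleftrightarrow>
    s \<in> {0, 1} \<and> t \<in> {0, 1}" (is "?x extreme_point_of ?P \<longleftrightarrow> _")
proof
  assume ext: "?x extreme_point_of ?P"
  then have "?x \<in> ?P" by (simp add: extreme_point_of_def)
  then have st: "0 \<le> s" "s \<le> 1" "0 \<le> t" "t \<le> 1" using mem_parallelogram[OF assms] by auto
  have uv: "u \<noteq> 0" "v \<noteq> 0" using assms by auto
  have 1: "p + t *\<^sub>R v \<in> ?P" "p + u + t *\<^sub>R v \<in> ?P" "p + s *\<^sub>R u \<in> ?P" "p + s *\<^sub>R u + v \<in> ?P"
    using mem_parallelogram[OF assms, of p 0 t] mem_parallelogram[OF assms, of p 1 t]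
      mem_parallelogram[OF assms, of p s 0] mem_parallelogram[OF assms, of p s 1] st by simp_all
  show "s \<in> {0, 1} \<and> t \<in> {0, 1}"
  proof (rule ccontr)
    assume "\<not> ?thesis"
    then consider "0 < s" "s < 1" | "0 < t" "t < 1" using st by force
    then show False
    proof cases
      case 1
      have "?x \<in> open_segment (p + t *\<^sub>R v) (p + u + t *\<^sub>R v)"
        using uv 1 by (auto simp: in_segment algebra_simps intro!: exI[of _ s])
      then show ?thesis using ext \<open>p + t *\<^sub>R v \<in> ?P\<close> \<open>p + u + t *\<^sub>R v \<in> ?P\<close>
        by (auto simp: extreme_point_of_def)
    next
      case 2
      have "?x \<in> open_segment (p + s *\<^sub>R u) (p + s *\<^sub>R u + v)"
        using uv 2 by (auto simp: in_segment algebra_simps intro!: exI[of _ t])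
      then show ?thesis using ext 1 by (auto simp: extreme_point_of_def)
    qed
  qed
next
  assume st: "s \<in> {0, 1} \<and> t \<in> {0, 1}"
  have aux: "a = b" if "(1 - l) * a + l * b = c" "0 < l" "l < 1" "c = 0 \<or> c = 1"
    "0 \<le> a" "a \<le> 1" "0 \<le> b" "b \<le> 1" for a b c l :: real
  proof (cases "c = 0")
    case True
    have "(1 - l) * a \<ge> 0" "l * b \<ge> 0" using that by simp_all
    then have "(1 - l) * a = 0" "l * b = 0" using True that(1) by linarith+
    then show ?thesis using that by simp
  next
    case False
    have "(1 - l) * (1 - a) \<ge> 0" "l * (1 - b) \<ge> 0" using that by simp_all
    moreover have "(1 - l) * (1 - a) + l * (1 - b) = 0"
      using that False by (simp add: algebra_simps)
    ultimately have "(1 - l) * (1 - a) = 0" "l * (1 - b) = 0" by linarith+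
    then show ?thesis using that by simp
  qed
  show "?x extreme_point_of ?P"
    unfolding extreme_point_of_def
  proof (intro conjI ballI notI)
    show "?x \<in> ?P" using st mem_parallelogram[OF assms] by auto
    fix a b assume ab: "a \<in> ?P" "b \<in> ?P" and x: "?x \<in> open_segment a b"
    from ab(1) obtain s1 t1 where a: "a = p + s1 *\<^sub>R u + t1 *\<^sub>R v" "0 \<le> s1" "s1 \<le> 1" "0 \<le> t1" "t1 \<le> 1"
      by (auto simp: parallelogram_at_def)
    from ab(2) obtain s2 t2 where b: "b = p + s2 *\<^sub>R u + t2 *\<^sub>R v" "0 \<le> s2" "s2 \<le> 1" "0 \<le> t2" "t2 \<le> 1"
      by (auto simp: parallelogram_at_def)
    from x obtain l where l: "?x = (1 - l) *\<^sub>R a + l *\<^sub>R b" "0 < l" "l < 1" and "a \<noteq> b"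
      by (auto simp: in_segment)
    have "s *\<^sub>R u + t *\<^sub>R v = ((1 - l) * s1 + l * s2) *\<^sub>R u + ((1 - l) * t1 + l * t2) *\<^sub>R v"
      using l(1) a b by (simp add: algebra_simps)
    from cr_inj[OF assms this] have "s = (1 - l) * s1 + l * s2" "t = (1 - l) * t1 + l * t2" .
    then have "s1 = s2" "t1 = t2"
      using aux[of l s1 s2 s] aux[of l t1 t2 t] st a b l by auto
    then show False using a b \<open>a \<noteq> b\<close> by simp
  qed
qed

text \<open>The vertices are intrinsic, being the extreme points, so the four corners of one
  representation have coordinates 0 or 1 in the other. The first conclusion says that the centres
  agree.\<close>

lemma parallelogram_eqD:
  assumes eq: "parallelogram_at p u v = parallelogram_at p' u' v'" and nz: "cr u v \<noteq> 0"
  shows "2 *\<^sub>R p + u + v = 2 *\<^sub>R p' + u' + v'"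
    and "(u' = u \<or> u' = - u) \<and> (v' = v \<or> v' = - v) \<or> (u' = v \<or> u' = - v) \<and> (v' = u \<or> v' = - u)"
proof -
  have nz': "cr u' v' \<noteq> 0"
    using eq nz interior_parallelogram_nonempty_iff by metis
  have *: "\<exists>a b. q = p + a *\<^sub>R u + b *\<^sub>R v \<and> a \<in> {0, 1} \<and> b \<in> {0, 1}"
    if "q extreme_point_of parallelogram_at p u v" for q
  proof -
    have "q \<in> parallelogram_at p u v" using that by (simp add: extreme_point_of_def)
    then obtain a b where "q = p + a *\<^sub>R u + b *\<^sub>R v" by (auto simp: parallelogram_at_def)
    then show ?thesis using that extreme_point_parallelogram[OF nz] by blast
  qed
  note e = extreme_point_parallelogram[OF nz', of p', folded eq]
  obtain a1 b1 where 1: "p' = p + a1 *\<^sub>R u + b1 *\<^sub>R v" "a1 \<in> {0, 1}" "b1 \<in> {0, 1}"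
    using *[of p'] e[of 0 0] by auto
  obtain a2 b2 where 2: "p' + u' = p + a2 *\<^sub>R u + b2 *\<^sub>R v" "a2 \<in> {0, 1}" "b2 \<in> {0, 1}"
    using *[of "p' + u'"] e[of 1 0] by auto
  obtain a3 b3 where 3: "p' + v' = p + a3 *\<^sub>R u + b3 *\<^sub>R v" "a3 \<in> {0, 1}" "b3 \<in> {0, 1}"
    using *[of "p' + v'"] e[of 0 1] by auto
  obtain a4 b4 where 4: "p' + u' + v' = p + a4 *\<^sub>R u + b4 *\<^sub>R v" "a4 \<in> {0, 1}" "b4 \<in> {0, 1}"
    using *[of "p' + u' + v'"] e[of 1 1] by auto
  have u': "u' = (a2 - a1) *\<^sub>R u + (b2 - b1) *\<^sub>R v" and v': "v' = (a3 - a1) *\<^sub>R u + (b3 - b1) *\<^sub>R v"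
    using 1(1) 2(1) 3(1) by (simp_all add: algebra_simps)
  have "p + (a1 + (a2 - a1) + (a3 - a1)) *\<^sub>R u + (b1 + (b2 - b1) + (b3 - b1)) *\<^sub>R v = p + a4 *\<^sub>R u + b4 *\<^sub>R v"
    using 4(1) 1(1) u' v' by (simp add: algebra_simps)
  then have "(a1 + (a2 - a1) + (a3 - a1)) *\<^sub>R u + (b1 + (b2 - b1) + (b3 - b1)) *\<^sub>R v = a4 *\<^sub>R u + b4 *\<^sub>R v"
    by (simp add: add.assoc)
  from cr_inj[OF nz this] have s: "a2 + a3 - a1 = a4" "b2 + b3 - b1 = b4" by simp_all
  have d: "(a2 - a1) * (b3 - b1) - (b2 - b1) * (a3 - a1) \<noteq> 0"
  proof -
    have "cr u' v' = ((a2 - a1) * (b3 - b1) - (b2 - b1) * (a3 - a1)) * cr u v"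
      unfolding u' v' by (simp add: cr_swap[of v u] algebra_simps)
    then show ?thesis using nz' by auto
  qed
  \<comment> \<open>If both \<open>a2\<close> and \<open>a3\<close> differed from \<open>a1\<close>,
    the fourth corner would have the coordinate 2 or -1.\<close>
  have a: "a2 = a1 \<or> a3 = a1" and b: "b2 = b1 \<or> b3 = b1"
    using 1(2,3) 2(2,3) 3(2,3) 4(2,3) s by auto
  then consider "b2 = b1" "a3 = a1" "a2 \<noteq> a1" "b3 \<noteq> b1" | "a2 = a1" "b3 = b1" "b2 \<noteq> b1" "a3 \<noteq> a1"
    using d by (cases "a2 = a1"; cases "b2 = b1") auto
  then have "(2 *\<^sub>R p + u + v = 2 *\<^sub>R p' + u' + v') \<and>
    ((u' = u \<or> u' = - u) \<and> (v' = v \<or> v' = - v) \<or> (u' = v \<or> u' = - v) \<and> (v' = u \<or> v' = - u))"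
  proof cases
    case 1
    then have "a2 = 1 - a1" "b3 = 1 - b1" using \<open>a1 \<in> {0, 1}\<close> \<open>b1 \<in> {0, 1}\<close> 2(2) 3(3) by auto
    then have uv: "u' = (1 - 2 * a1) *\<^sub>R u" "v' = (1 - 2 * b1) *\<^sub>R v" using 1 u' v' by auto
    show ?thesis unfolding uv \<open>p' = _\<close> using \<open>a1 \<in> {0, 1}\<close> \<open>b1 \<in> {0, 1}\<close>
      by (auto simp: algebra_simps scaleR_2)
  next
    case 2
    then have "b2 = 1 - b1" "a3 = 1 - a1" using \<open>a1 \<in> {0, 1}\<close> \<open>b1 \<in> {0, 1}\<close> \<open>b2 \<in> {0, 1}\<close> 3(2) by auto
    then have uv: "u' = (1 - 2 * b1) *\<^sub>R v" "v' = (1 - 2 * a1) *\<^sub>R u" using 2 u' v' by auto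
    show ?thesis unfolding uv \<open>p' = _\<close> using \<open>a1 \<in> {0, 1}\<close> \<open>b1 \<in> {0, 1}\<close>
      by (auto simp: algebra_simps scaleR_2)
  qed
  then show "2 *\<^sub>R p + u + v = 2 *\<^sub>R p' + u' + v'"
    "(u' = u \<or> u' = - u) \<and> (v' = v \<or> v' = - v) \<or> (u' = v \<or> u' = - v) \<and> (v' = u \<or> v' = - u)"
    by blast+
qed

text \<open>The sign condition says that \<open>k *\<^sub>R a\<close> points to the same side of the
  edge as \<open>v\<close>; a small enough push then moves only slightly along the edge, away from
  its ends.\<close>

lemma edge_midpoint_push:
  assumes nz: "cr u v \<noteq> 0" and nz0: "cr u a \<noteq> 0"
  obtains d where "d > 0" "\<And>k. 0 < k * cr u a * cr u v \<Longrightarrow> \<bar>k\<bar> \<le> d \<Longrightarrow>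
    q + (1/2) *\<^sub>R u + k *\<^sub>R a \<in> interior (parallelogram_at q u v)"
proof -
  define \<alpha> where "\<alpha> = cr a v / cr u v"
  define \<beta> where "\<beta> = cr u a / cr u v"
  have a: "a = \<alpha> *\<^sub>R u + \<beta> *\<^sub>R v" unfolding \<alpha>_def \<beta>_def by (rule vec_eq_cr_cr[OF nz])
  define d where "d = 1 / (2 * (\<bar>\<alpha>\<bar> + \<bar>\<beta>\<bar> + 1))"
  have d: "d > 0" by (simp add: d_def add_nonneg_pos)
  show ?thesis
  proof (rule that[OF d])
    fix k :: real assume k: "0 < k * cr u a * cr u v" "\<bar>k\<bar> \<le> d"
    have "\<bar>k\<bar> * (\<bar>\<alpha>\<bar> + \<bar>\<beta>\<bar> + 1) \<le> 1/2" using k(2) by (simp add: d_def field_simps)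
    then have "\<bar>k\<bar> * \<bar>\<alpha>\<bar> + \<bar>k\<bar> * \<bar>\<beta>\<bar> + \<bar>k\<bar> \<le> 1/2" by (simp add: algebra_simps)
    moreover have "\<bar>k\<bar> * \<bar>\<alpha>\<bar> \<ge> 0" "\<bar>k\<bar> * \<bar>\<beta>\<bar> \<ge> 0" "\<bar>k\<bar> > 0" using k by auto
    ultimately have "\<bar>k * \<alpha>\<bar> < 1/2" "\<bar>k * \<beta>\<bar> < 1/2" unfolding abs_mult by linarith+
    moreover have "k * \<beta> = (k * cr u a * cr u v) / (cr u v)\<^sup>2"
      using nz by (simp add: \<beta>_def power2_eq_square)
    then have "k * \<beta> > 0" using k(1) nz by simp
    ultimately have "q + (1/2 + k * \<alpha>) *\<^sub>R u + (k * \<beta>) *\<^sub>R v \<in> interior (parallelogram_at q u v)"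
      by (intro interior_parallelogramI[OF nz]) (auto simp: abs_less_iff)
    then show "q + (1/2) *\<^sub>R u + k *\<^sub>R a \<in> interior (parallelogram_at q u v)"
      by (simp add: a algebra_simps)
  qed
qed

lemma isometry_image_parallelogram:
  fixes f :: "real^2 \<Rightarrow> real^2"
  assumes "\<forall>x y. dist (f x) (f y) = dist x y"
  obtains g where "orthogonal_transformation g"
    "\<And>p u v. f ` parallelogram_at p u v = parallelogram_at (f p) (g u) (g v)"
proof -
  define g where "g x = f x - f 0" for x
  have g: "orthogonal_transformation g"
    unfolding orthogonal_transformation_isometry using assms by (simp add: g_def dist_norm)
  then have lin: "linear g" by (rule orthogonal_transformation_linear)
  have f: "f x = f 0 + g x" for x by (simp add: g_def)
  have "f (p + s *\<^sub>R u + t *\<^sub>R v) = f p + s *\<^sub>R g u + t *\<^sub>R g v" for p u v s t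
    using lin by (simp add: f[of p] f[of "p + s *\<^sub>R u + t *\<^sub>R v"] linear_add linear_cmul)
  then have "f ` parallelogram_at p u v = parallelogram_at (f p) (g u) (g v)" for p u v
    unfolding parallelogram_at_def by (auto simp: image_iff) metis+
  then show ?thesis using g that by blast
qed

section \<open>Tiles and their edge vectors\<close>

locale ptiling =
  fixes \<T> :: "(real^2) set set"
  assumes tiling: "parallelogram_tiling \<T>"
    and locally_finite: "locally_finite_tiling \<T>"
    and vertex_to_vertex: "vertex_to_vertex \<T>"
    and finite_protoset: "finite (protoset \<T>)"
begin

definition tile :: "real^2 \<Rightarrow> real^2 \<Rightarrow> real^2 \<Rightarrow> bool" where
  "tile p u v \<longleftrightarrow> parallelogram_at p u v \<in> \<T>"

definition edges :: "(real^2) set" where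
  "edges = {u. \<exists>p v. tile p u v}"

lemma tile_cr_nonzero: "tile p u v \<Longrightarrow> cr u v \<noteq> 0"
  using tiling interior_parallelogram_nonempty_iff[of p u v]
  by (auto simp: tile_def parallelogram_tiling_def nondegenerate_parallelogram_def)

lemma tile_swap: "tile p v u \<longleftrightarrow> tile p u v"
  by (simp add: tile_def parallelogram_swap)

lemma tile_flip: "tile (p + v) u (- v) \<longleftrightarrow> tile p u v" "tile (p + u) (- u) v \<longleftrightarrow> tile p u v"
  by (simp_all add: tile_def parallelogram_flip parallelogram_flip')

lemma edges_uminus: "u \<in> edges \<Longrightarrow> - u \<in> edges"
  unfolding edges_def using tile_flip by blast

lemma edges_nonzero: "u \<in> edges \<Longrightarrow> u \<noteq> 0"
  unfolding edges_def using tile_cr_nonzero by fastforce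

lemma tile_exists:
  assumes "P \<in> \<T>"
  obtains p u v where "P = parallelogram_at p u v" "tile p u v"
  using assms tiling unfolding parallelogram_tiling_def nondegenerate_parallelogram_def tile_def by metis

text \<open>A convex set with nonempty interior lies in the closure of its interior, so the open set
  \<open>interior P\<close>, once it meets \<open>Q\<close>, also meets
  \<open>interior Q\<close>.\<close>

lemma tiles_eqI:
  assumes P: "P \<in> \<T>" and Q: "Q \<in> \<T>" and x: "x \<in> interior P" "x \<in> Q"
  shows "P = Q"
proof (rule ccontr)
  assume "P \<noteq> Q"
  then have disj: "interior P \<inter> interior Q = {}"
    using tiling P Q unfolding parallelogram_tiling_def by blast
  obtain q u v where q: "Q = parallelogram_at q u v" "tile q u v" using tile_exists[OF Q] .
  have "interior Q \<noteq> {}" using q interior_parallelogram_nonempty_iff tile_cr_nonzero by blast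
  then have "closure (interior Q) = closure Q"
    unfolding q(1) by (intro convex_closure_interior convex_parallelogram)
  then have "x \<in> closure (interior Q)" using x closure_subset by blast
  then show False
    using disj x(1) open_Int_closure_eq_empty[of "interior P" "interior Q"] by auto
qed

section \<open>Consequences of the finite protoset\<close>

lemma norm_inner_finite:
  "finite {(norm u, norm v, u \<bullet> v) |u v. \<exists>p. tile p u v}" (is "finite ?F")
proof -
  define rep where "rep X = (SOME (p, u, v). tile p u v \<and>
    X = congruence_rel `` {parallelogram_at p u v})" for X
  \<comment> \<open>One chosen tile per congruence class fixes the triple up to exchanging the two
    edges and reversing one of them, which leaves the four variants in \<open>G\<close>.\<close>
  define G where "G X = (case rep X of (p, u, v) \<Rightarrow>
    {(norm u, norm v, u \<bullet> v), (norm v, norm u, u \<bullet> v),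
     (norm u, norm v, - (u \<bullet> v)), (norm v, norm u, - (u \<bullet> v))})" for X
  have "?F \<subseteq> (\<Union>X \<in> protoset \<T>. G X)"
  proof clarify
    fix u v p assume t: "tile p u v"
    let ?P = "parallelogram_at p u v"
    let ?X = "congruence_rel `` {?P}"
    have X: "?X \<in> protoset \<T>" using t unfolding protoset_def tile_def by (rule quotientI)
    have "\<exists>z. (\<lambda>(p, u, v). tile p u v \<and> ?X = congruence_rel `` {parallelogram_at p u v}) z"
      using t by blast
    from someI_ex[OF this, folded rep_def] obtain p0 u0 v0
      where rep: "rep ?X = (p0, u0, v0)" "tile p0 u0 v0"
        "?X = congruence_rel `` {parallelogram_at p0 u0 v0}"
      by (cases "rep ?X") auto
    have "?P \<in> ?X" unfolding congruence_rel_def by (auto intro!: exI[of _ "\<lambda>x. x"])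
    then have "?P \<in> congruence_rel `` {parallelogram_at p0 u0 v0}" using rep(3) by simp
    then obtain f :: "real^2 \<Rightarrow> real^2"
      where f: "\<forall>x y. dist (f x) (f y) = dist x y" "f ` parallelogram_at p0 u0 v0 = ?P"
      unfolding congruence_rel_def by auto
    obtain g where g: "orthogonal_transformation g"
      "\<And>p u v. f ` parallelogram_at p u v = parallelogram_at (f p) (g u) (g v)"
      using isometry_image_parallelogram[OF f(1)] by blast
    have "?P = parallelogram_at (f p0) (g u0) (g v0)" using f g by metis
    from parallelogram_eqD(2)[OF this tile_cr_nonzero[OF t]]
    have uv: "(g u0 = u \<or> g u0 = - u) \<and> (g v0 = v \<or> g v0 = - v) \<or>
      (g u0 = v \<or> g u0 = - v) \<and> (g v0 = u \<or> g v0 = - u)" .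
    have gn: "norm u0 = norm (g u0)" "norm v0 = norm (g v0)" "u0 \<bullet> v0 = g u0 \<bullet> g v0"
      using g(1) orthogonal_transformation_norm[OF g(1)] by (auto simp: orthogonal_transformation_def)
    have "(norm u, norm v, u \<bullet> v) \<in> G ?X"
      unfolding G_def rep(1) using uv by (auto simp: gn inner_commute)
    then show "(norm u, norm v, u \<bullet> v) \<in> (\<Union>X \<in> protoset \<T>. G X)" using X by blast
  qed
  moreover have "finite (G X)" for X unfolding G_def by (auto split: prod.split)
  moreover from this have "finite (\<Union>X \<in> protoset \<T>. G X)" using finite_protoset by simp
  ultimately show ?thesis by (meson finite_subset)
qed

lemma edge_lengths_finite: "finite (norm ` edges)"
proof -
  have "norm ` edges = fst ` {(norm u, norm v, u \<bullet> v) |u v. \<exists>p. tile p u v}"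
    by (force simp: edges_def image_iff)
  then show ?thesis using norm_inner_finite by simp
qed

text \<open>The length of \<open>v\<close> and its inner product with \<open>u\<close> determine
  \<open>v\<close> up to reflection in the line of \<open>u\<close>; these are the two candidates in
  \<open>h\<close>.\<close>

lemma tile_finite_image:
  assumes "u \<noteq> 0"
  shows "finite {v. \<exists>p. tile p u v}" (is "finite ?S")
proof -
  let ?F = "{(norm u, norm v, u \<bullet> v) |u v. \<exists>p. tile p u v}"
  define h where "h = (\<lambda>(a::real, b, c). let d = sqrt (a\<^sup>2 * b\<^sup>2 - c\<^sup>2) in
    {(1 / (u \<bullet> u)) *\<^sub>R (c *\<^sub>R u + d *\<^sub>R vector [- u$2, u$1]),
     (1 / (u \<bullet> u)) *\<^sub>R (c *\<^sub>R u - d *\<^sub>R vector [- u$2, u$1])})"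
  have "?S \<subseteq> (\<Union>z\<in>?F. h z)"
  proof clarify
    fix v p assume t: "tile p u v"
    have "(u \<bullet> u) *\<^sub>R v = (u \<bullet> v) *\<^sub>R u + cr u v *\<^sub>R vector [- u$2, u$1]"
      by (simp add: vec_eq_iff forall_2 inner_vec2 cr_def vector_2 algebra_simps)
    then have "(1 / (u \<bullet> u)) *\<^sub>R ((u \<bullet> u) *\<^sub>R v) = (1 / (u \<bullet> u)) *\<^sub>R ((u \<bullet> v) *\<^sub>R u + cr u v *\<^sub>R vector [- u$2, u$1])"
      by simp
    then have v: "v = (1 / (u \<bullet> u)) *\<^sub>R ((u \<bullet> v) *\<^sub>R u + cr u v *\<^sub>R vector [- u$2, u$1])"
      using assms by simp
    have "(norm u)\<^sup>2 * (norm v)\<^sup>2 - (u \<bullet> v)\<^sup>2 = (cr u v)\<^sup>2"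
      using cr_sq_plus_inner_sq[of u v] by linarith
    then have "sqrt ((norm u)\<^sup>2 * (norm v)\<^sup>2 - (u \<bullet> v)\<^sup>2) = \<bar>cr u v\<bar>" by simp
    then have "v \<in> h (norm u, norm v, u \<bullet> v)"
      using v unfolding h_def by (cases "cr u v \<ge> 0") (simp_all add: Let_def)
    moreover have "(norm u, norm v, u \<bullet> v) \<in> ?F" using t by blast
    ultimately show "v \<in> (\<Union>z\<in>?F. h z)" by (rule UN_I[rotated])
  qed
  moreover have "finite (h z)" for z by (auto simp: h_def Let_def split: prod.split)
  moreover from this have "finite (\<Union>z\<in>?F. h z)" using norm_inner_finite by simp
  ultimately show ?thesis by (meson finite_subset)
qed

text \<open>Minima of positive quantities over a finite set: \<open>c\<close> bounds the areas of
  the tiles from below, \<epsilon> the sines of their interior angles.\<close>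

lemma cr_lower_bounds:
  obtains c \<epsilon> where "c > 0" "\<epsilon> > 0"
    "\<And>p u v. tile p u v \<Longrightarrow> c \<le> \<bar>cr u v\<bar>"
    "\<And>p u v. tile p u v \<Longrightarrow> \<epsilon> * (norm u * norm v) \<le> \<bar>cr u v\<bar>"
proof -
  let ?F = "{(norm u, norm v, u \<bullet> v) |u v. \<exists>p. tile p u v}"
  define A where "A = (\<lambda>(a::real, b, c). sqrt (a\<^sup>2 * b\<^sup>2 - c\<^sup>2)) ` ?F"
  define B where "B = (\<lambda>(a::real, b, c). sqrt (a\<^sup>2 * b\<^sup>2 - c\<^sup>2) / (a * b)) ` ?F"
  have fin: "finite A" "finite B" using norm_inner_finite by (auto simp: A_def B_def)
  have s: "sqrt ((norm u)\<^sup>2 * (norm v)\<^sup>2 - (u \<bullet> v)\<^sup>2) = \<bar>cr u v\<bar>" for u v :: "real^2"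
  proof -
    have "(norm u)\<^sup>2 * (norm v)\<^sup>2 - (u \<bullet> v)\<^sup>2 = (cr u v)\<^sup>2"
      using cr_sq_plus_inner_sq[of u v] by linarith
    then show ?thesis by simp
  qed
  have nz: "cr u v \<noteq> 0" "u \<noteq> 0" "v \<noteq> 0" if "tile p u v" for p u v
    using tile_cr_nonzero[OF that] by auto
  have pos: "\<forall>x\<in>A. 0 < x" "\<forall>x\<in>B. 0 < x"
  proof -
    have "0 < sqrt ((norm u)\<^sup>2 * (norm v)\<^sup>2 - (u \<bullet> v)\<^sup>2)" "0 < norm u * norm v" if "tile p u v" for p u v
      using nz[OF that] by (simp_all only: s) simp_all
    then show "\<forall>x\<in>A. 0 < x" "\<forall>x\<in>B. 0 < x"
      unfolding A_def B_def by (fastforce intro: divide_pos_pos)+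
  qed
  have *: "\<exists>e>0. \<forall>x\<in>S. e \<le> x" if "finite S" "\<forall>x\<in>S. 0 < x" for S :: "real set"
  proof (cases "S = {}")
    case False
    then show ?thesis using that by (intro exI[of _ "Min S"]) simp
  qed (auto intro: exI[of _ 1])
  obtain c where c: "c > 0" "\<forall>x\<in>A. c \<le> x" using *[OF fin(1) pos(1)] by blast
  obtain \<epsilon> where \<epsilon>: "\<epsilon> > 0" "\<forall>x\<in>B. \<epsilon> \<le> x" using *[OF fin(2) pos(2)] by blast
  show ?thesis
  proof (rule that[OF c(1) \<epsilon>(1)])
    fix p u v assume t: "tile p u v"
    then have F: "(norm u, norm v, u \<bullet> v) \<in> ?F" by blast
    have "\<bar>cr u v\<bar> \<in> A" unfolding A_def by (rule image_eqI[OF _ F]) (simp add: s)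
    then show "c \<le> \<bar>cr u v\<bar>" using c by blast
    have "\<bar>cr u v\<bar> / (norm u * norm v) \<in> B" unfolding B_def by (rule image_eqI[OF _ F]) (simp add: s)
    then have "\<epsilon> \<le> \<bar>cr u v\<bar> / (norm u * norm v)" using \<epsilon> by blast
    then show "\<epsilon> * (norm u * norm v) \<le> \<bar>cr u v\<bar>"
      using nz[OF t] by (simp add: pos_le_divide_eq)
  qed
qed

section \<open>Consequences of local finiteness\<close>

lemma finite_reps: "finite {(p, u, v). parallelogram_at p u v = P \<and> cr u v \<noteq> 0}" (is "finite ?S")
proof (cases "?S = {}")
  case False
  then obtain p0 u0 v0 where 0: "parallelogram_at p0 u0 v0 = P" "cr u0 v0 \<noteq> 0" by auto
  let ?E = "{u0, - u0, v0, - v0}"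
  have "?S \<subseteq> (\<lambda>(u, v). ((1/2) *\<^sub>R (2 *\<^sub>R p0 + u0 + v0 - u - v), u, v)) ` (?E \<times> ?E)"
  proof clarify
    fix p u v assume "P = parallelogram_at p u v" "cr u v \<noteq> 0"
    then have eq: "parallelogram_at p0 u0 v0 = parallelogram_at p u v" using 0 by simp
    have "2 *\<^sub>R p0 + u0 + v0 - u - v = 2 *\<^sub>R p" using parallelogram_eqD(1)[OF eq 0(2)] by simp
    then have "p = (1/2) *\<^sub>R (2 *\<^sub>R p0 + u0 + v0 - u - v)" by simp
    moreover have "(u, v) \<in> ?E \<times> ?E" using parallelogram_eqD(2)[OF eq 0(2)] by auto
    ultimately show "(p, u, v) \<in> (\<lambda>(u, v). ((1/2) *\<^sub>R (2 *\<^sub>R p0 + u0 + v0 - u - v), u, v)) ` (?E \<times> ?E)"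
      by (metis (no_types, lifting) case_prod_conv image_eqI)
  qed
  then show ?thesis by (rule finite_subset) auto
next
  case True
  show ?thesis unfolding True by simp
qed

lemma finite_tiles_meeting_bounded:
  assumes "bounded B"
  shows "finite {(p, u, v). tile p u v \<and> parallelogram_at p u v \<inter> B \<noteq> {}}" (is "finite ?S")
proof -
  obtain r where r: "B \<subseteq> ball 0 r" using assms bounded_subset_ballD by blast
  have "finite {P \<in> \<T>. ball 0 r \<inter> P \<noteq> {}}"
    using locally_finite unfolding locally_finite_tiling_def by blast
  moreover have "?S \<subseteq> (\<Union>P\<in>{P \<in> \<T>. ball 0 r \<inter> P \<noteq> {}}.
      {(p, u, v). parallelogram_at p u v = P \<and> cr u v \<noteq> 0})"
    using r tile_cr_nonzero by (fastforce simp: tile_def)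
  moreover have "finite (\<Union>P\<in>{P \<in> \<T>. ball 0 r \<inter> P \<noteq> {}}. {(p, u, v). parallelogram_at p u v = P \<and> cr u v \<noteq> 0})"
    using calculation(1) finite_reps by simp
  ultimately show ?thesis by (meson finite_subset)
qed

text \<open>From the midpoint of the common edge, a small move along \<open>v\<close> stays in the
  first tile and enters the interior of the second.\<close>

lemma tile_side_unique:
  assumes t: "tile p u v" "tile p u v'" and pos: "cr u v * cr u v' > 0"
  shows "v = v'"
proof -
  have nz: "cr u v \<noteq> 0" "cr u v' \<noteq> 0" using t tile_cr_nonzero by auto
  obtain d where d: "d > 0" "\<And>k. 0 < k * cr u v * cr u v' \<Longrightarrow> \<bar>k\<bar> \<le> d \<Longrightarrow>
      p + (1/2) *\<^sub>R u + k *\<^sub>R v \<in> interior (parallelogram_at p u v')"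
    using edge_midpoint_push[OF nz(2,1), of p] by metis
  have "p + (1/2) *\<^sub>R u + min d 1 *\<^sub>R v \<in> interior (parallelogram_at p u v')"
    using d(1) pos by (intro d(2)) (auto simp: mult.assoc)
  moreover have "p + (1/2) *\<^sub>R u + min d 1 *\<^sub>R v \<in> parallelogram_at p u v"
    unfolding mem_parallelogram[OF nz(1)] using d(1) by auto
  ultimately have eq: "parallelogram_at p u v = parallelogram_at p u v'"
    using tiles_eqI t unfolding tile_def by blast
  then show ?thesis using parallelogram_eqD(1)[OF eq nz(1)] by simp
qed

text \<open>This is where vertex-to-vertex is used: the tile beyond an edge must have exactly that
  edge, with the same end points, so a worm can always be continued.\<close>

lemma adjacent_tile:
  assumes t: "tile p u v"
  obtains v' where "tile (p + v) u v'" "cr u v * cr u v' > 0"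
proof -
  define q where "q = p + v"
  define x where "x = q + (1/2) *\<^sub>R u"
  let ?P = "parallelogram_at q u (- v)"
  have P: "?P \<in> \<T>" using t by (simp add: q_def tile_def parallelogram_flip)
  have nz: "cr u (- v) \<noteq> 0" using tile_cr_nonzero[OF t] by simp
  then have u0: "u \<noteq> 0" by auto
  have x: "x = q + (1/2) *\<^sub>R u + 0 *\<^sub>R (- v)" by (simp add: x_def)
  have xP: "x \<in> ?P" "\<not> x extreme_point_of ?P"
    unfolding x mem_parallelogram[OF nz] extreme_point_parallelogram[OF nz] by auto
  \<comment> \<open>The tiles near \<open>x\<close> that miss \<open>x\<close> are finitely many
    closed sets, so a small ball around \<open>x\<close> avoids them all; \<open>y\<close> is a
    point of that ball just beyond the edge.\<close>
  obtain y \<tau> Q where y: "y = x + \<tau> *\<^sub>R v" "\<tau> > 0" "Q \<in> \<T>" "y \<in> Q" "x \<in> Q"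
  proof -
    let ?F = "{Q \<in> \<T>. ball x 1 \<inter> Q \<noteq> {} \<and> x \<notin> Q}"
    have "finite {Q \<in> \<T>. ball x 1 \<inter> Q \<noteq> {}}"
      using locally_finite unfolding locally_finite_tiling_def by blast
    then have fin: "finite ?F" by (rule rev_finite_subset) blast
    have "closed Q" if "Q \<in> \<T>" for Q
      using tile_exists[OF that] closed_parallelogram tile_cr_nonzero by metis
    then have "closed (\<Union>?F)" using fin by (intro closed_Union) auto
    then have "open (ball x 1 - \<Union>?F)" by blast
    moreover have "x \<in> ball x 1 - \<Union>?F" by auto
    ultimately obtain d where d: "d > 0" "ball x d \<subseteq> ball x 1 - \<Union>?F"
      by (meson open_contains_ball)
    define \<tau> where "\<tau> = d / (2 * (norm v + 1))"
    have \<tau>: "\<tau> > 0" using d(1) by (auto simp: \<tau>_def intro!: divide_pos_pos add_nonneg_pos)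
    have "\<tau> * norm v < d"
    proof -
      have "\<tau> * norm v \<le> \<tau> * (norm v + 1)" using \<tau> by simp
      also have "\<dots> = d / 2"
      proof -
        have "norm v + 1 \<noteq> 0" using norm_ge_zero[of v] by linarith
        then show ?thesis unfolding \<tau>_def by (simp add: divide_simps)
      qed
      finally show ?thesis using d(1) by simp
    qed
    then have y: "x + \<tau> *\<^sub>R v \<in> ball x d" using \<tau> by (simp add: dist_norm)
    have "x + \<tau> *\<^sub>R v \<in> \<Union>\<T>" using tiling unfolding parallelogram_tiling_def by simp
    then obtain Q where Q: "Q \<in> \<T>" "x + \<tau> *\<^sub>R v \<in> Q" by blast
    then have "x \<in> Q" using y d(2) by blast
    then show ?thesis using that[OF refl \<tau> Q] by simp
  qed
  have "y \<notin> ?P"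
  proof
    assume "y \<in> ?P"
    moreover have "y = q + (1/2) *\<^sub>R u + (- \<tau>) *\<^sub>R (- v)" by (simp add: y x_def)
    ultimately show False using mem_parallelogram[OF nz, of q "1/2" "- \<tau>"] y(2) by simp
  qed
  then have "Q \<noteq> ?P" using y by auto
  then have notint: "interior Q \<inter> ?P = {}" "interior ?P \<inter> Q = {}"
    using tiles_eqI[OF y(3) P] tiles_eqI[OF P y(3)] by auto
  have vQ: "\<not> x extreme_point_of Q"
    using vertex_to_vertex y(3,5) P xP unfolding vertex_to_vertex_def by blast
  \<comment> \<open>\<open>x\<close> lies strictly inside an edge of \<open>Q\<close>: it is no
    vertex of \<open>Q\<close>, since it is none of \<open>?P\<close>, and no interior point of
    \<open>Q\<close>, since it belongs to \<open>?P\<close>. The flips bring each of the four edges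
    into the same form.\<close>
  have "\<exists>q' a b s. Q = parallelogram_at q' a b \<and> cr a b \<noteq> 0 \<and> x = q' + s *\<^sub>R a \<and> 0 < s \<and> s < 1"
  proof -
    obtain q' a b where Q: "Q = parallelogram_at q' a b" "tile q' a b" using tile_exists[OF y(3)] .
    note nz' = tile_cr_nonzero[OF Q(2)]
    then have nz'': "cr b a \<noteq> 0" by (simp add: cr_swap[of a b])
    obtain s t where st: "x = q' + s *\<^sub>R a + t *\<^sub>R b" "0 \<le> s" "s \<le> 1" "0 \<le> t" "t \<le> 1"
      using y(5) Q(1) by (auto simp: parallelogram_at_def)
    have 1: "\<not> ((s = 0 \<or> s = 1) \<and> (t = 0 \<or> t = 1))" using vQ extreme_point_parallelogram[OF nz'] Q(1) st(1) by simp
    have 2: "\<not> (0 < s \<and> s < 1 \<and> 0 < t \<and> t < 1)"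
      using interior_parallelogramI[OF nz', of s t q'] notint(1) xP(1) Q(1) st(1) by auto
    consider "t = 0" "0 < s" "s < 1" | "t = 1" "0 < s" "s < 1" | "s = 0" "0 < t" "t < 1" | "s = 1" "0 < t" "t < 1"
    proof -
      have "s = 0 \<or> s = 1 \<or> 0 < s \<and> s < 1" "t = 0 \<or> t = 1 \<or> 0 < t \<and> t < 1" using st(2-) by linarith+
      then show ?thesis using 1 2 that by blast
    qed
    then show ?thesis
    proof cases
      case 1
      then show ?thesis using Q(1) st(1) nz' by auto
    next
      case 2
      have "Q = parallelogram_at (q' + b) a (- b)" using Q(1) by (simp add: parallelogram_flip)
      moreover have "x = (q' + b) + s *\<^sub>R a" using 2 st by (simp add: algebra_simps)
      ultimately show ?thesis using 2 nz' by (metis cr_simps(6) neg_equal_0_iff_equal)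
    next
      case 3
      have "Q = parallelogram_at q' b a" using Q(1) by (simp add: parallelogram_swap)
      moreover have "x = q' + t *\<^sub>R b" using 3 st by simp
      ultimately show ?thesis using 3 nz'' by blast
    next
      case 4
      have "Q = parallelogram_at (q' + a) b (- a)"
        using Q(1) parallelogram_swap[of q' a b] by (simp add: parallelogram_flip)
      moreover have "x = (q' + a) + t *\<^sub>R b" using 4 st by (simp add: algebra_simps)
      ultimately show ?thesis using 4 nz'' by (metis cr_simps(6) neg_equal_0_iff_equal)
    qed
  qed
  then obtain q0 a0 b s0 where 0: "Q = parallelogram_at q0 a0 b" "cr a0 b \<noteq> 0" "x = q0 + s0 *\<^sub>R a0" "0 < s0" "s0 < 1"
    by blast
  \<comment> \<open>An edge of \<open>Q\<close> through \<open>x\<close> in another direction than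
    \<open>u\<close> would run into the interior of \<open>?P\<close>.\<close>
  have par: "cr u a0 = 0"
  proof (rule ccontr)
    assume nz0: "cr u a0 \<noteq> 0"
    obtain d where d: "d > 0" "\<And>k. 0 < k * cr u a0 * cr u (- v) \<Longrightarrow> \<bar>k\<bar> \<le> d \<Longrightarrow>
        q + (1/2) *\<^sub>R u + k *\<^sub>R a0 \<in> interior ?P"
      using edge_midpoint_push[OF nz nz0, of q] by metis
    define m where "m = min (min s0 (1 - s0)) d"
    define k where "k = sgn (cr u a0 * cr u (- v)) * m"
    have m: "0 < m" "m \<le> s0" "m \<le> 1 - s0" "m \<le> d"
      using 0 d(1) by (auto simp: m_def)
    have k: "\<bar>k\<bar> = m" "0 < k * (cr u a0 * cr u (- v))" using m(1) nz nz0
      by (auto simp: k_def abs_mult sgn_if zero_less_mult_iff mult_less_0_iff)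
    have "x + k *\<^sub>R a0 \<in> interior ?P" unfolding x_def using d(2)[of k] k m(4) by (simp add: mult.assoc)
    moreover have "x + k *\<^sub>R a0 = q0 + (s0 + k) *\<^sub>R a0 + 0 *\<^sub>R b" using 0 by (simp add: algebra_simps)
    moreover have "0 \<le> s0 + k" "s0 + k \<le> 1" using k(1) m by linarith+
    ultimately have "x + k *\<^sub>R a0 \<in> interior ?P \<inter> Q"
      using mem_parallelogram[OF 0(2), of q0 "s0 + k" 0] 0(1) by auto
    then show False using notint by blast
  qed
  define l0 where "l0 = a0 \<bullet> u / (u \<bullet> u)"
  have l0: "a0 = l0 *\<^sub>R u" using cr_eq_0_parallel[OF par u0] by (simp add: l0_def)
  have "\<exists>q' l s. Q = parallelogram_at q' (l *\<^sub>R u) b \<and> cr u b \<noteq> 0 \<and> l > 0 \<and> x = q' + s *\<^sub>R l *\<^sub>R u \<and> 0 < s \<and> s < 1"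
  proof (cases "l0 > 0")
    case True
    then show ?thesis using 0 l0 by auto
  next
    case False
    have "Q = parallelogram_at (q0 + a0) ((- l0) *\<^sub>R u) b" using 0(1) l0 parallelogram_flip'[of q0 a0 b] by simp
    moreover have "x = (q0 + a0) + (1 - s0) *\<^sub>R ((- l0) *\<^sub>R u)" using 0(3) l0 by (simp add: algebra_simps)
    moreover have "cr u b \<noteq> 0" "- l0 > 0" using 0(2) l0 False by auto
    ultimately show ?thesis using 0(4,5)
      by (intro exI[of _ "q0 + a0"] exI[of _ "- l0"] exI[of _ "1 - s0"]) simp
  qed
  then obtain q' l s where Q: "Q = parallelogram_at q' (l *\<^sub>R u) b" "cr u b \<noteq> 0" "l > 0"
    "x = q' + s *\<^sub>R l *\<^sub>R u" "0 < s" "s < 1" by blast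
  have nzQ: "cr (l *\<^sub>R u) b \<noteq> 0" using Q by simp
  \<comment> \<open>On the line of points q + r u, the edge of \<open>?P\<close> occupies [0, 1] and
    the edge of \<open>Q\<close> occupies [m, n].\<close>
  define m where "m = 1/2 - s * l"
  define n where "n = m + l"
  have q': "q' = q + m *\<^sub>R u" using Q(4) by (simp add: x_def m_def algebra_simps)
  have mn: "m < 1/2" "1/2 < n" using Q(3,5,6) by (auto simp: m_def n_def algebra_simps)
  have PQ: "z extreme_point_of Q" if "z extreme_point_of ?P" "z \<in> Q" for z
    using that vertex_to_vertex P y(3) unfolding vertex_to_vertex_def by blast
  have QP: "z extreme_point_of ?P" if "z extreme_point_of Q" "z \<in> ?P" for z
    using that vertex_to_vertex P y(3) unfolding vertex_to_vertex_def by blast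
  have onP: "q + r *\<^sub>R u \<in> ?P \<longleftrightarrow> 0 \<le> r \<and> r \<le> 1" "(q + r *\<^sub>R u) extreme_point_of ?P \<longleftrightarrow> r \<in> {0, 1}" for r
    using mem_parallelogram[OF nz, of q r 0] extreme_point_parallelogram[OF nz, of q r 0] by auto
  have onQ: "q + r *\<^sub>R u \<in> Q \<longleftrightarrow> 0 \<le> (r - m) / l \<and> (r - m) / l \<le> 1"
    "(q + r *\<^sub>R u) extreme_point_of Q \<longleftrightarrow> (r - m) / l \<in> {0, 1}" for r
  proof -
    have "((r - m) / l) *\<^sub>R l *\<^sub>R u = (r - m) *\<^sub>R u" using Q(3) by simp
    then have "q + r *\<^sub>R u = q' + ((r - m) / l) *\<^sub>R l *\<^sub>R u + 0 *\<^sub>R b"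
      by (simp add: q' scaleR_left_diff_distrib)
    then show "q + r *\<^sub>R u \<in> Q \<longleftrightarrow> 0 \<le> (r - m) / l \<and> (r - m) / l \<le> 1"
      "(q + r *\<^sub>R u) extreme_point_of Q \<longleftrightarrow> (r - m) / l \<in> {0, 1}"
      using mem_parallelogram[OF nzQ, of q' "(r - m) / l" 0] extreme_point_parallelogram[OF nzQ, of q' "(r - m) / l" 0] Q(1)
      by auto
  qed
  \<comment> \<open>An end of one edge strictly inside the other would be a vertex of one tile that
    lies in the other tile without being its vertex. Both ends of both edges are treated in this
    way.\<close>
  have "m \<le> 0" using QP[of "q + m *\<^sub>R u"] onP[of m] onQ[of m] mn by force
  moreover have "n \<ge> 1" using QP[of "q + n *\<^sub>R u"] onP[of n] onQ[of n] mn Q(3) by (force simp: n_def)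
  moreover have "m \<ge> 0" using PQ[of "q + 0 *\<^sub>R u"] onP[of 0] onQ[of 0] mn Q(3) by (force simp: n_def field_simps)
  moreover have "n \<le> 1" using PQ[of "q + 1 *\<^sub>R u"] onP[of 1] onQ[of 1] mn Q(3) by (force simp: n_def field_simps)
  ultimately have "m = 0" "l = 1" by (auto simp: n_def)
  then have Q': "Q = parallelogram_at q u b" using Q(1) q' by simp
  \<comment> \<open>Membership of \<open>y\<close> in \<open>Q\<close> decides on which side of the
    edge \<open>Q\<close> lies.\<close>
  obtain s' t' where "y = q + s' *\<^sub>R u + t' *\<^sub>R b" "0 \<le> t'"
    using y(4) unfolding Q' parallelogram_at_def by blast
  then have "cr u (x + \<tau> *\<^sub>R v - q) = cr u (s' *\<^sub>R u + t' *\<^sub>R b)" using y(1) by (simp add: algebra_simps)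
  then have \<tau>: "\<tau> * cr u v = t' * cr u b" by (simp add: x_def)
  then have "t' > 0" using \<open>0 \<le> t'\<close> y(2) nz by (cases "t' = 0") auto
  have "cr u v * cr u b = (t' / \<tau>) * (cr u b)\<^sup>2" using \<tau> y(2) by (simp add: power2_eq_square field_simps)
  also have "\<dots> > 0" using \<open>t' > 0\<close> y(2) Q(2) by simp
  finally show ?thesis using that[of b] y(3) Q' by (simp add: q_def tile_def)
qed

end

section \<open>Worms\<close>

lemma int_step_growth:
  fixes h :: "int \<Rightarrow> real"
  assumes "\<And>n. h n + c \<le> h (n + 1)" "m \<le> n"
  shows "h m + of_int (n - m) * c \<le> h n"
  using assms(2)
proof (induction n rule: int_ge_induct)
  case (step i)
  then show ?case using assms(1)[of i] by (simp add: algebra_simps)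
qed simp

lemma int_step_strict_mono:
  fixes h :: "int \<Rightarrow> real"
  assumes "\<And>n. h n + c \<le> h (n + 1)" "c > 0" "m < n"
  shows "h m < h n"
proof -
  have "0 < of_int (n - m) * c" using assms by simp
  then show ?thesis using int_step_growth[where h = h and c = c, OF assms(1), of m n] assms(3) by linarith
qed

lemma int_step_bracket:
  fixes h :: "int \<Rightarrow> real"
  assumes step: "\<And>n. h n + c \<le> h (n + 1)" and c: "c > 0"
  obtains n where "h n \<le> t" "t < h (n + 1)"
proof -
  define k where "k = \<lceil>(\<bar>t\<bar> + \<bar>h 0\<bar> + 1) / c\<rceil>"
  have k0: "k \<ge> 0" unfolding k_def using c
    by (meson abs_ge_zero add_nonneg_nonneg divide_nonneg_pos le_of_int_ceiling of_int_0_le_iff order_trans zero_le_one)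
  have k: "of_int k * c \<ge> \<bar>t\<bar> + \<bar>h 0\<bar> + 1"
    using le_of_int_ceiling[of "(\<bar>t\<bar> + \<bar>h 0\<bar> + 1) / c"] c unfolding k_def
    by (simp only: pos_divide_le_eq)
  have lo: "h (- k) \<le> t" using int_step_growth[where h = h and c = c, OF step, of "- k" 0] k0 k by simp
  have hi: "t < h k" using int_step_growth[where h = h and c = c, OF step, of 0 k] k0 k by simp
  have "t < h b \<Longrightarrow> \<exists>n. h n \<le> t \<and> t < h (n + 1)" if "- k \<le> b" for b
    using that
  proof (induction b rule: int_ge_induct)
    case base then show ?case using lo by simp
  next
    case (step i) then show ?case by (metis not_less)
  qed
  from this[of k] hi k0 show ?thesis using that by auto
qed

lemma int_step_bracket_unique:
  fixes h :: "int \<Rightarrow> real"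
  assumes step: "\<And>n. h n + c \<le> h (n + 1)" and c: "c > 0"
    and "h n \<le> t" "t < h (n + 1)" "h m \<le> t" "t < h (m + 1)"
  shows "n = m"
proof (rule ccontr)
  assume "n \<noteq> m"
  have *: "h a \<le> h b" if "a \<le> b" for a b
    using int_step_strict_mono[where h = h and c = c, OF step c, of a b] that by (cases "a = b") auto
  from \<open>n \<noteq> m\<close> consider "n + 1 \<le> m" | "m + 1 \<le> n" by linarith
  then show False using *[of "n + 1" m] *[of "m + 1" n] assms by cases auto
qed

text \<open>Every zero is crossed upwards. A first zero \<open>m\<close> to the right of
  \<open>z\<close> would be preceded by negative values, so the intermediate value theorem would
  produce a still earlier zero. The left half follows by applying this to the function sending s to
  - f (- s).\<close>

lemma increasing_zero_unique:
  fixes f :: "real \<Rightarrow> real"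
  assumes cont: "continuous_on UNIV f"
    and zero: "\<And>z. f z = 0 \<Longrightarrow> \<exists>\<delta>>0. \<forall>\<tau>. \<bar>\<tau>\<bar> \<le> \<delta> \<longrightarrow> f (z + \<tau>) = \<tau>"
    and z: "f z = 0"
  shows "z < t \<Longrightarrow> 0 < f t" "t < z \<Longrightarrow> f t < 0"
proof -
  have main: "0 < f t" if cont: "continuous_on UNIV f"
    and zero: "\<And>z. f z = 0 \<Longrightarrow> \<exists>\<delta>>0. \<forall>\<tau>. \<bar>\<tau>\<bar> \<le> \<delta> \<longrightarrow> f (z + \<tau>) = \<tau>"
    and z: "f z = 0" and zt: "z < t" for f :: "real \<Rightarrow> real" and z t
  proof (rule ccontr)
    assume neg: "\<not> 0 < f t"
    have ivt: "\<exists>x\<ge>a. x \<le> b \<and> f x = 0" if "f b \<le> 0" "0 \<le> f a" "a \<le> b" for a b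
      using IVT2'[of f b 0 a] that continuous_on_subset[OF cont] by auto
    obtain \<delta> where \<delta>: "\<delta> > 0" "\<And>\<tau>. \<bar>\<tau>\<bar> \<le> \<delta> \<Longrightarrow> f (z + \<tau>) = \<tau>" using zero[OF z] by blast
    define a where "a = z + min \<delta> (t - z)"
    have a: "f a > 0" "a \<le> t" using \<delta>(2)[of "min \<delta> (t - z)"] \<delta>(1) zt by (auto simp: a_def)
    let ?Z = "{s \<in> {a..t}. f s = 0}"
    have "continuous_on {a..t} f" using cont continuous_on_subset by blast
    then have "closed ?Z" by (intro continuous_closed_preimage_constant) auto
    then have "compact ({a..t} \<inter> ?Z)" by (intro compact_Int_closed) auto
    moreover have "{a..t} \<inter> ?Z = ?Z" by auto
    ultimately have "compact ?Z" by (simp only:)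
    moreover have "?Z \<noteq> {}" using ivt[of t a] neg a by force
    ultimately have "\<exists>m\<in>?Z. \<forall>s\<in>?Z. m \<le> s" by (rule compact_attains_inf)
    then obtain m where m: "m \<in> ?Z" "\<And>s. s \<in> ?Z \<Longrightarrow> m \<le> s" by blast
    have am: "a < m" using m(1) a(1) by (cases "a = m") auto
    obtain \<delta>' where \<delta>': "\<delta>' > 0" "\<And>\<tau>. \<bar>\<tau>\<bar> \<le> \<delta>' \<Longrightarrow> f (m + \<tau>) = \<tau>" using zero m(1) by blast
    define b where "b = m - min \<delta>' (m - a)"
    have b: "f b < 0" "b < m" "a \<le> b" using \<delta>'(2)[of "- min \<delta>' (m - a)"] \<delta>'(1) am by (auto simp: b_def)
    then obtain s where "a \<le> s" "s \<le> b" "f s = 0" using ivt[of b a] a by auto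
    then have "s \<in> ?Z" using b m(1) by auto
    then show False using m(2)[of s] \<open>s \<le> b\<close> b(2) by linarith
  qed
  show "z < t \<Longrightarrow> 0 < f t" by (rule main[OF cont zero z])
  show "f t < 0" if "t < z"
  proof -
    have "0 < (\<lambda>s. - f (- s)) (- t)"
    proof (rule main[where f = "\<lambda>s. - f (- s)" and z = "- z"])
      show "continuous_on UNIV (\<lambda>s. - f (- s))"
      proof -
        have "continuous_on UNIV (f \<circ> uminus)"
          by (intro continuous_on_compose continuous_on_subset[OF cont]) (auto intro: continuous_intros)
        then show ?thesis by (auto intro: continuous_on_minus simp: o_def)
      qed
      show "\<exists>\<delta>>0. \<forall>\<tau>. \<bar>\<tau>\<bar> \<le> \<delta> \<longrightarrow> - f (- (w + \<tau>)) = \<tau>" if "- f (- w) = 0" for w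
      proof -
        have fw: "f (- w) = 0" using that by simp
        obtain \<delta> where \<delta>: "\<delta> > 0" "\<And>\<tau>. \<bar>\<tau>\<bar> \<le> \<delta> \<Longrightarrow> f (- w + \<tau>) = \<tau>"
          using zero[OF fw] by blast
        have "- f (- (w + \<tau>)) = \<tau>" if "\<bar>\<tau>\<bar> \<le> \<delta>" for \<tau> using \<delta>(2)[of "- \<tau>"] that by simp
        then show ?thesis using \<delta>(1) by blast
      qed
    qed (use z that in auto)
    then show ?thesis by simp
  qed
qed

text \<open>The polygonal midline through the edge midpoints, parametrised by the height
  \<open>cr u\<close> and not by the index, so that it is a graph over the height. The half-open
  intervals make the index unique when \<open>P\<close> is a worm.\<close>

definition worm_curve :: "real^2 \<Rightarrow> (int \<Rightarrow> real^2) \<Rightarrow> real \<Rightarrow> real^2" where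
  "worm_curve u P t = (let n = (THE n. cr u (P n) \<le> t \<and> t < cr u (P (n + 1))) in
     P n + (1/2) *\<^sub>R u + ((t - cr u (P n)) / cr u (P (n + 1) - P n)) *\<^sub>R (P (n + 1) - P n))"

text \<open>The displacement along \<open>u\<close>, in units of \<open>u\<close>, from the midline
  point at the height of \<open>x\<close>. Positive values lie on the side to which \<open>u\<close>
  points, called the right of the worm.\<close>

definition side :: "real^2 \<Rightarrow> (int \<Rightarrow> real^2) \<Rightarrow> real^2 \<Rightarrow> real" where
  "side u P x = (x - worm_curve u P (cr u x)) \<bullet> u / (u \<bullet> u)"

section \<open>Existence of worms\<close>

context ptiling begin

text \<open>The crossed edges run from \<open>P n\<close> to \<open>P n + u\<close>. The sign
  condition fixes the direction of travel, so that heights increase with the index.\<close>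

definition worm :: "real^2 \<Rightarrow> (int \<Rightarrow> real^2) \<Rightarrow> bool" where
  "worm u P \<longleftrightarrow> (\<forall>n. tile (P n) u (P (n + 1) - P n) \<and> cr u (P (n + 1) - P n) > 0)"

lemma wormD:
  assumes "worm u P"
  shows "tile (P n) u (P (n + 1) - P n)" "cr u (P (n + 1) - P n) > 0"
  using assms by (auto simp: worm_def)

lemma worm_edge: "worm u P \<Longrightarrow> u \<in> edges"
  unfolding edges_def using wormD by blast

lemma worm_nonzero: "worm u P \<Longrightarrow> u \<noteq> 0"
  using worm_edge edges_nonzero by blast

lemma worm_exists:
  assumes t: "tile p u v" and pos: "cr u v > 0"
  obtains P where "worm u P" "P 0 = p" "P 1 = p + v"
proof -
  define good where "good z \<longleftrightarrow> tile (fst z) u (snd z) \<and> cr u (snd z) > 0" for z :: "(real^2) \<times> (real^2)"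
  have fw: "\<exists>z'. good z' \<and> fst z' = fst z + snd z" if z: "good z" for z
  proof -
    obtain v' where "tile (fst z + snd z) u v'" "cr u (snd z) * cr u v' > 0"
      using adjacent_tile[of "fst z" u "snd z"] z unfolding good_def by blast
    then show ?thesis using z
      by (intro exI[of _ "(fst z + snd z, v')"]) (auto simp: good_def zero_less_mult_iff)
  qed
  \<comment> \<open>Going backwards means crossing the lower edge of the flipped tile; the tile
    found there hangs downwards by \<open>v'\<close> and is re-based at its lower corner.\<close>
  have bw: "\<exists>z'. good z' \<and> fst z = fst z' + snd z'" if "good z" for z
  proof -
    have "tile (fst z + snd z) u (- snd z)" using that by (simp add: good_def tile_flip)
    then obtain v' where v': "tile (fst z + snd z + - snd z) u v'" "cr u (- snd z) * cr u v' > 0"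
      using adjacent_tile by blast
    then have "cr u v' < 0" "tile (fst z + v') u (- v')" using that
      by (auto simp: good_def zero_less_mult_iff mult_less_0_iff tile_flip)
    then show ?thesis by (intro exI[of _ "(fst z + v', - v')"]) (auto simp: good_def)
  qed
  have g0: "good (p, v)" using t pos by (simp add: good_def)
  have "\<exists>f. \<forall>n::nat. (good (f n) \<and> (n = 0 \<longrightarrow> f n = (p, v))) \<and> fst (f (Suc n)) = fst (f n) + snd (f n)"
    by (rule dependent_nat_choice) (use g0 fw in auto)
  then obtain f where f: "\<And>n::nat. good (f n)" "f 0 = (p, v)" "\<And>n. fst (f (Suc n)) = fst (f n) + snd (f n)"
    by auto
  have "\<exists>g. \<forall>n::nat. (good (g n) \<and> (n = 0 \<longrightarrow> g n = (p, v))) \<and> fst (g n) = fst (g (Suc n)) + snd (g (Suc n))"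
    by (rule dependent_nat_choice) (use g0 bw in auto)
  then obtain g where g: "\<And>n::nat. good (g n)" "g 0 = (p, v)" "\<And>n. fst (g n) = fst (g (Suc n)) + snd (g (Suc n))"
    by auto
  define P where "P n = (if n \<ge> 0 then fst (f (nat n)) else fst (g (nat (- n))))" for n
  have "tile (P n) u (P (n + 1) - P n) \<and> cr u (P (n + 1) - P n) > 0" for n
  proof (cases "n \<ge> 0")
    case True
    then have "nat (n + 1) = Suc (nat n)" by simp
    then have "P n = fst (f (nat n))" "P (n + 1) = fst (f (nat n)) + snd (f (nat n))"
      using True f(3) by (auto simp: P_def)
    then show ?thesis using f(1)[of "nat n"] by (simp add: good_def)
  next
    case False
    define k where "k = nat (- n - 1)"
    have k: "nat (- n) = Suc k" using False by (simp add: k_def)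
    have "P (n + 1) = fst (g k)"
      using False f(2) g(2) by (cases "n = -1") (auto simp: P_def k_def)
    moreover have "P n = fst (g (Suc k))" using False k by (simp add: P_def)
    ultimately have "P n = fst (g (Suc k))" "P (n + 1) - P n = snd (g (Suc k))" using g(3)[of k] by auto
    then show ?thesis using g(1)[of "Suc k"] by (simp add: good_def)
  qed
  then show ?thesis using that[of P] f(2) f(3)[of 0] by (auto simp: worm_def P_def)
qed

section \<open>The midline as a graph over the height\<close>

lemma worm_height_step:
  obtains c where "c > 0" "\<And>u P n. worm u P \<Longrightarrow> cr u (P n) + c \<le> cr u (P (n + 1))"
proof -
  obtain c \<epsilon> where c: "c > 0" "\<And>p u v. tile p u v \<Longrightarrow> c \<le> \<bar>cr u v\<bar>" using cr_lower_bounds by metis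
  have "cr u (P n) + c \<le> cr u (P (n + 1))" if "worm u P" for u P n
    using c(2)[OF wormD(1)[OF that, of n]] wormD(2)[OF that, of n] by simp
  then show ?thesis using that c(1) by blast
qed

lemma worm_bracket:
  assumes "worm u P"
  obtains n where "cr u (P n) \<le> t" "t < cr u (P (n + 1))"
proof -
  obtain c where "c > 0" "\<And>u P n. worm u P \<Longrightarrow> cr u (P n) + c \<le> cr u (P (n + 1))"
    using worm_height_step by blast
  then show ?thesis using int_step_bracket[of "\<lambda>n. cr u (P n)" c t] assms that by blast
qed

lemma worm_height_mono:
  assumes "worm u P" "m \<le> n"
  shows "cr u (P m) \<le> cr u (P n)"
proof -
  obtain c where "c > 0" "\<And>u P n. worm u P \<Longrightarrow> cr u (P n) + c \<le> cr u (P (n + 1))"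
    using worm_height_step by blast
  then show ?thesis using int_step_strict_mono[of "\<lambda>n. cr u (P n)" c m n] assms by (cases "m = n") auto
qed

lemma worm_curve_half_open:
  assumes w: "worm u P" and t: "cr u (P n) \<le> t" "t < cr u (P (n + 1))"
  shows "worm_curve u P t = P n + (1/2) *\<^sub>R u + ((t - cr u (P n)) / cr u (P (n + 1) - P n)) *\<^sub>R (P (n + 1) - P n)"
proof -
  obtain c where c: "c > 0" "\<And>u P n. worm u P \<Longrightarrow> cr u (P n) + c \<le> cr u (P (n + 1))"
    using worm_height_step by blast
  have "(THE n. cr u (P n) \<le> t \<and> t < cr u (P (n + 1))) = n"
    using t int_step_bracket_unique[of "\<lambda>n. cr u (P n)" c] c w by (intro the_equality) auto
  then show ?thesis by (simp add: worm_curve_def)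
qed

text \<open>The affine formula extends to the closed interval because the next piece begins where
  this one ends.\<close>

lemma worm_curve_piece:
  assumes w: "worm u P" and t: "cr u (P n) \<le> t" "t \<le> cr u (P (n + 1))"
  shows "worm_curve u P t = P n + (1/2) *\<^sub>R u + ((t - cr u (P n)) / cr u (P (n + 1) - P n)) *\<^sub>R (P (n + 1) - P n)"
proof (cases "t < cr u (P (n + 1))")
  case True
  then show ?thesis using worm_curve_half_open[OF w t(1)] by simp
next
  case False
  then have t': "t = cr u (P (n + 1))" using t by simp
  have "cr u (P (n + 1)) < cr u (P (n + 1 + 1))" using wormD(2)[OF w, of "n + 1"] by simp
  then have "worm_curve u P t = P (n + 1) + (1/2) *\<^sub>R u"
    using worm_curve_half_open[OF w, of "n + 1" t] t' by simp
  moreover have "(t - cr u (P n)) / cr u (P (n + 1) - P n) = 1" using wormD(2)[OF w, of n] t' by simp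
  ultimately show ?thesis by simp
qed

lemma worm_curve_affine:
  assumes w: "worm u P" and s: "0 \<le> s" "s \<le> 1"
  shows "worm_curve u P (cr u (P n) + s * cr u (P (n + 1) - P n)) =
    P n + (1/2) *\<^sub>R u + s *\<^sub>R (P (n + 1) - P n)"
proof -
  let ?d = "cr u (P (n + 1) - P n)"
  have d: "?d > 0" by (rule wormD(2)[OF w])
  have "0 \<le> s * ?d" "s * ?d \<le> 1 * ?d" using d s by (auto simp only: mult_right_mono less_imp_le mult_nonneg_nonneg)
  then show ?thesis using worm_curve_piece[OF w, of n "cr u (P n) + s * ?d"] d by simp
qed

lemma cr_worm_curve [simp]:
  assumes w: "worm u P"
  shows "cr u (worm_curve u P t) = t"
proof -
  obtain n where "cr u (P n) \<le> t" "t < cr u (P (n + 1))" using worm_bracket[OF w] .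
  then show ?thesis using worm_curve_half_open[OF w, of n t] wormD(2)[OF w, of n] by simp
qed

text \<open>The midline is affine on each step, so a slope bound for the steps passes to arcs by
  cutting them at the step heights. It is applied with a slope \<open>- K\<close> for the Lipschitz
  estimate, with slope 0 for a curve that has stopped rising, and with a positive slope for a
  steadily rising one.\<close>

lemma worm_curve_mono:
  assumes w: "worm u P" and L: "linear L"
    and slope: "\<And>n. n \<ge> N \<Longrightarrow> \<kappa> * cr u (P (n + 1) - P n) \<le> L (P (n + 1) - P n)"
    and st: "cr u (P N) \<le> s" "s \<le> t"
  shows "\<kappa> * (t - s) \<le> L (worm_curve u P t) - L (worm_curve u P s)"
proof -
  let ?h = "\<lambda>n. cr u (P n)" and ?g = "worm_curve u P"
  have piece: "\<kappa> * (b - a) \<le> L (?g b) - L (?g a)"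
    if ab: "?h n \<le> a" "a \<le> b" "b \<le> ?h (n + 1)" "n \<ge> N" for a b n
  proof -
    let ?v = "P (n + 1) - P n"
    have d: "cr u ?v > 0" by (rule wormD(2)[OF w])
    have "?g b - ?g a = ((b - ?h n) / cr u ?v - (a - ?h n) / cr u ?v) *\<^sub>R ?v"
      using ab worm_curve_piece[OF w, of n a] worm_curve_piece[OF w, of n b]
      by (simp add: scaleR_left_diff_distrib)
    also have "(b - ?h n) / cr u ?v - (a - ?h n) / cr u ?v = (b - a) / cr u ?v"
      by (simp only: diff_divide_distrib[symmetric]) simp
    finally have "L (?g b - ?g a) = ((b - a) / cr u ?v) * L ?v"
      by (simp only: linear_cmul[OF L] real_scaleR_def)
    then have "L (?g b) - L (?g a) = ((b - a) / cr u ?v) * L ?v"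
      by (simp only: linear_diff[OF L])
    moreover have "((b - a) / cr u ?v) * (\<kappa> * cr u ?v) \<le> ((b - a) / cr u ?v) * L ?v"
      using slope[OF ab(4)] d ab(2) by (intro mult_left_mono) auto
    moreover have "((b - a) / cr u ?v) * (\<kappa> * cr u ?v) = \<kappa> * (b - a)" using d by (simp del: cr_simps)
    ultimately show ?thesis by linarith
  qed
  obtain m where m: "?h m \<le> s" "s < ?h (m + 1)" using worm_bracket[OF w] .
  have mN: "m \<ge> N"
  proof (rule ccontr)
    assume "\<not> m \<ge> N"
    then have "?h (m + 1) \<le> ?h N" by (intro worm_height_mono[OF w]) simp
    then show False using st m by linarith
  qed
  have claim: "s \<le> t \<Longrightarrow> t \<le> ?h (k + 1) \<Longrightarrow> \<kappa> * (t - s) \<le> L (?g t) - L (?g s)" if "m \<le> k" for k t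
    using that
  proof (induction k arbitrary: t rule: int_ge_induct)
    case base
    then show ?case using piece[of m s t] m mN by simp
  next
    case (step k)
    show ?case
    proof (cases "t \<le> ?h (k + 1)")
      case True then show ?thesis using step by simp
    next
      case False
      have "s \<le> ?h (k + 1)" using worm_height_mono[OF w, of "m + 1" "k + 1"] step(1) m by simp
      then have "\<kappa> * (?h (k + 1) - s) \<le> L (?g (?h (k + 1))) - L (?g s)" using step.IH by simp
      moreover have "\<kappa> * (t - ?h (k + 1)) \<le> L (?g t) - L (?g (?h (k + 1)))"
        using piece[of "k + 1" "?h (k + 1)" t] step False mN by simp
      ultimately show ?thesis by (simp add: algebra_simps)
    qed
  qed
  obtain k where k: "?h k \<le> t" "t < ?h (k + 1)" using worm_bracket[OF w] .
  have "m \<le> k"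
  proof (rule ccontr)
    assume "\<not> m \<le> k"
    then have "?h (k + 1) \<le> ?h m" by (intro worm_height_mono[OF w]) simp
    then show False using st m k by linarith
  qed
  then show ?thesis using claim[of k t] k st by simp
qed

text \<open>A step has length at most \<open>M\<close> and gains height at least \<open>c\<close>,
  so each coordinate has slope at most \<open>M / c\<close>; adding the two coordinates doubles
  this.\<close>

lemma worm_curve_lipschitz:
  assumes w: "worm u P"
  obtains K where "\<And>s t. norm (worm_curve u P t - worm_curve u P s) \<le> K * \<bar>t - s\<bar>"
proof -
  let ?g = "worm_curve u P"
  obtain c \<epsilon> where c: "c > 0" "\<And>p u v. tile p u v \<Longrightarrow> c \<le> \<bar>cr u v\<bar>" using cr_lower_bounds by metis
  obtain M where M: "\<And>v. v \<in> edges \<Longrightarrow> norm v \<le> M"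
    using finite_imp_bounded[OF edge_lengths_finite] unfolding bounded_iff by auto
  define K where "K = M / c"
  have Mc: "norm (P (n + 1) - P n) \<le> K * cr u (P (n + 1) - P n)" for n
  proof -
    let ?v = "P (n + 1) - P n"
    have v: "tile (P n) u ?v" by (rule wormD[OF w])
    then have "?v \<in> edges" using tile_swap unfolding edges_def by blast
    then have "norm ?v \<le> M" by (rule M)
    moreover have "c \<le> cr u ?v" using c(2)[OF v] wormD(2)[OF w, of n] by simp
    moreover have "M \<ge> 0" using \<open>norm ?v \<le> M\<close> norm_ge_zero[of ?v] by linarith
    ultimately have "norm ?v * c \<le> M * cr u ?v" using c(1) by (intro mult_mono) auto
    then show ?thesis using c(1) by (simp add: K_def field_simps)
  qed
  have le: "L (?g t) - L (?g s) \<ge> - (K * (t - s))" if "s \<le> t" "linear L" "\<And>z. \<bar>L z\<bar> \<le> norm z" for L s t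
  proof -
    obtain N where N: "cr u (P N) \<le> s" using worm_bracket[OF w] by metis
    have "- K * cr u (P (n + 1) - P n) \<le> L (P (n + 1) - P n)" for n
      using that(3)[of "P (n + 1) - P n"] Mc[of n] by (simp add: abs_le_iff)
    from worm_curve_mono[OF w that(2) this N that(1)] show ?thesis by simp
  qed
  have comp: "\<bar>?g t $ i - ?g s $ i\<bar> \<le> K * (t - s)" if "s \<le> t" for s t i
  proof -
    have "linear (\<lambda>x::real^2. x $ i)" "linear (\<lambda>x::real^2. - x $ i)" by (auto intro!: linearI)
    moreover have "\<bar>z $ i\<bar> \<le> norm z" "\<bar>- z $ i\<bar> \<le> norm z" for z :: "real^2"
      using component_le_norm_cart[of z i] by simp_all
    ultimately have "- (K * (t - s)) \<le> ?g t $ i - ?g s $ i" "- (K * (t - s)) \<le> - ?g t $ i - - ?g s $ i"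
      using le[OF that] by metis+
    then show ?thesis by (simp add: abs_le_iff)
  qed
  have main: "norm (?g t - ?g s) \<le> (2 * K) * \<bar>t - s\<bar>" if "s \<le> t" for s t
    using norm_le_l1_cart[of "?g t - ?g s"] comp[OF that, of 1] comp[OF that, of 2] that by (simp add: UNIV_2)
  have "norm (?g t - ?g s) \<le> (2 * K) * \<bar>t - s\<bar>" for s t
    using main[of s t] main[of t s] by (cases "s \<le> t") (auto simp: norm_minus_commute abs_minus_commute)
  then show ?thesis using that by blast
qed

lemma worm_curve_continuous: "worm u P \<Longrightarrow> continuous_on UNIV (worm_curve u P)"
proof -
  assume "worm u P"
  then obtain K where K: "\<And>s t. norm (worm_curve u P t - worm_curve u P s) \<le> K * \<bar>t - s\<bar>"
    using worm_curve_lipschitz by blast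
  have "K \<ge> 0" using order_trans[OF norm_ge_zero K[of 1 0]] by simp
  then have "K-lipschitz_on UNIV (worm_curve u P)"
    using K by (intro lipschitz_onI) (auto simp: dist_norm)
  then show ?thesis by (rule lipschitz_on_continuous_on)
qed

lemma worm_curve_comp_continuous [continuous_intros]:
  "worm u P \<Longrightarrow> continuous_on S f \<Longrightarrow> continuous_on S (\<lambda>x. worm_curve u P (f x))"
  using continuous_on_compose2[OF worm_curve_continuous] by blast

lemma side_continuous [continuous_intros]:
  assumes "worm u P" "continuous_on S f"
  shows "continuous_on S (\<lambda>x. side u P (f x))"
  unfolding side_def
  by (intro continuous_intros worm_curve_comp_continuous[OF assms(1)] assms(2))
     (use worm_nonzero[OF assms(1)] in auto)

lemma side_decomp:
  assumes w: "worm u P"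
  shows "x = worm_curve u P (cr u x) + side u P x *\<^sub>R u"
proof -
  have "cr u (x - worm_curve u P (cr u x)) = 0" using w by simp
  from cr_eq_0_parallel[OF this worm_nonzero[OF w]] show ?thesis by (simp add: side_def algebra_simps)
qed

lemma side_add [simp]: "worm u P \<Longrightarrow> side u P (x + s *\<^sub>R u) = side u P x + s"
  using worm_nonzero[of u P] by (simp add: side_def inner_add_left inner_diff_left add_divide_distrib diff_divide_distrib)

lemma side_worm_curve [simp]: "worm u P \<Longrightarrow> side u P (worm_curve u P t) = 0"
  by (simp add: side_def)

lemma side_zeroD: "worm u P \<Longrightarrow> side u P x = 0 \<Longrightarrow> x = worm_curve u P (cr u x)"
  using side_decomp[of u P x] by simp

text \<open>A common point of the midlines forces a common tile, whose two edge directions are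
  \<open>u\<close> and \<open>u'\<close>, and the point is its centre. Within this tile the second
  worm runs parallel to \<open>u\<close>, so its crossing of the first is straight.\<close>

lemma worms_cross:
  assumes w: "worm u P" and w': "worm u' P'" and nz: "cr u' u \<noteq> 0"
    and eq: "worm_curve u' P' t' = worm_curve u P t"
  shows "\<exists>p. tile p u u'"
    and "\<exists>\<delta>>0. \<forall>\<tau>. \<bar>\<tau>\<bar> \<le> \<delta> \<longrightarrow>
      worm_curve u' P' (t' + \<tau>) = worm_curve u P t + (\<tau> / cr u' u) *\<^sub>R u"
proof -
  define x where "x = worm_curve u P t"
  have half: "\<exists>n s. x = P n + (1/2) *\<^sub>R u + s *\<^sub>R (P (n + 1) - P n) \<and> 0 \<le> s \<and> s < 1 \<and>
      t = cr u (P n) + s * cr u (P (n + 1) - P n)"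
    if w: "worm u P" and x: "x = worm_curve u P t" for u P t
  proof -
    obtain n where n: "cr u (P n) \<le> t" "t < cr u (P (n + 1))" using worm_bracket[OF w] .
    have d: "cr u (P (n + 1) - P n) > 0" by (rule wormD(2)[OF w])
    show ?thesis
      using worm_curve_half_open[OF w n] x n d
      by (intro exI[of _ n] exI[of _ "(t - cr u (P n)) / cr u (P (n + 1) - P n)"]) auto
  qed
  obtain n s where n: "x = P n + (1/2) *\<^sub>R u + s *\<^sub>R (P (n + 1) - P n)" "0 \<le> s" "s < 1"
    using half[OF w x_def] by blast
  obtain n' s' where n': "x = P' n' + (1/2) *\<^sub>R u' + s' *\<^sub>R (P' (n' + 1) - P' n')" "0 \<le> s'" "s' < 1"
    "t' = cr u' (P' n') + s' * cr u' (P' (n' + 1) - P' n')"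
    using half[OF w'] x_def eq by metis
  let ?v = "P (n + 1) - P n" and ?v' = "P' (n' + 1) - P' n'"
  let ?Q = "parallelogram_at (P n) u ?v" and ?Q' = "parallelogram_at (P' n') u' ?v'"
  have d: "cr u ?v > 0" and d': "cr u' ?v' > 0" using wormD(2) w w' by auto
  then have nzd: "cr u ?v \<noteq> 0" "cr u' ?v' \<noteq> 0" by auto
  have Q: "?Q \<in> \<T>" "?Q' \<in> \<T>" using wormD(1) w w' unfolding tile_def by auto
  have xQ: "x \<in> ?Q" "x \<in> ?Q'"
    using mem_parallelogram[OF nzd(1), of "P n" "1/2" s] mem_parallelogram[OF nzd(2), of "P' n'" "1/2" s'] n n' by simp_all
  have "?Q = ?Q'"
  proof -
    consider "s > 0" | "s' > 0" | "s = 0" "s' = 0" using n(2) n'(2) by linarith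
    then show ?thesis
    proof cases
      case 1
      then have "x \<in> interior ?Q" using interior_parallelogramI[OF nzd(1), of "1/2" s "P n"] n by simp
      then show ?thesis using tiles_eqI Q xQ by blast
    next
      case 2
      then have "x \<in> interior ?Q'" using interior_parallelogramI[OF nzd(2), of "1/2" s' "P' n'"] n' by simp
      then show ?thesis using tiles_eqI Q xQ by blast
    next
      \<comment> \<open>Here \<open>x\<close> is the midpoint of an edge \<open>u\<close> of
        \<open>?Q\<close> and of an edge \<open>u'\<close> of \<open>?Q'\<close>. Sliding along the
        former stays in \<open>?Q\<close> and, the edges not being parallel, can be directed into
        the interior of \<open>?Q'\<close>.\<close>
      case 3
      obtain \<delta> where \<delta>: "\<delta> > 0" "\<And>k. 0 < k * cr u' u * cr u' ?v' \<Longrightarrow> \<bar>k\<bar> \<le> \<delta> \<Longrightarrow>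
          P' n' + (1/2) *\<^sub>R u' + k *\<^sub>R u \<in> interior ?Q'"
        using edge_midpoint_push[OF nzd(2) nz, of "P' n'"] by metis
      define k where "k = sgn (cr u' u) * min \<delta> (1/2)"
      have "0 < k * cr u' u" "\<bar>k\<bar> \<le> \<delta>" "\<bar>k\<bar> \<le> 1/2"
        using \<delta>(1) nz by (auto simp: k_def sgn_if abs_mult mult_pos_neg mult_less_0_iff)
      then have "x + k *\<^sub>R u \<in> interior ?Q'" using \<delta>(2)[of k] d' n'(1) 3 by simp
      moreover have "x + k *\<^sub>R u = P n + (1/2 + k) *\<^sub>R u + 0 *\<^sub>R ?v" using n(1) 3 by (simp add: algebra_simps)
      then have "x + k *\<^sub>R u \<in> ?Q" using mem_parallelogram[OF nzd(1), of "P n" "1/2 + k" 0] abs_le_D1[OF \<open>\<bar>k\<bar> \<le> 1/2\<close>] abs_le_D2[OF \<open>\<bar>k\<bar> \<le> 1/2\<close>]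
        by simp
      ultimately show ?thesis using tiles_eqI Q by metis
    qed
  qed
  from parallelogram_eqD[OF this nzd(1)] have
    centre: "2 *\<^sub>R P n + u + ?v = 2 *\<^sub>R P' n' + u' + ?v'" and
    uv: "(u' = u \<or> u' = - u) \<and> (?v' = ?v \<or> ?v' = - ?v) \<or> (u' = ?v \<or> u' = - ?v) \<and> (?v' = u \<or> ?v' = - u)" .
  have "\<not> (u' = u \<or> u' = - u)" using nz by auto
  then have uv': "u' = ?v \<or> u' = - ?v" "?v' = u \<or> ?v' = - u" using uv by blast+
  show "\<exists>p. tile p u u'"
    using uv'(1) wormD(1)[OF w, of n] tile_flip(1)[of "P n" ?v u] tile_flip(1)[of "P n" u ?v] by metis
  \<comment> \<open>Both sides are twice the displacement of \<open>x\<close> from the common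
    centre, one parallel to \<open>u'\<close> and the other to \<open>u\<close>, so both
    vanish.\<close>
  have "(2 * s - 1) *\<^sub>R ?v = (2 * s' - 1) *\<^sub>R ?v'"
  proof -
    have "2 *\<^sub>R x = 2 *\<^sub>R P n + u + (2 * s) *\<^sub>R ?v"
      by (subst n(1)) (simp add: scaleR_add_right)
    moreover have "2 *\<^sub>R x = 2 *\<^sub>R P' n' + u' + (2 * s') *\<^sub>R ?v'"
      by (subst n'(1)) (simp add: scaleR_add_right)
    ultimately have "(2 *\<^sub>R P n + u + (2 * s) *\<^sub>R ?v) - (2 *\<^sub>R P n + u + ?v) =
        (2 *\<^sub>R P' n' + u' + (2 * s') *\<^sub>R ?v') - (2 *\<^sub>R P' n' + u' + ?v')"
      using centre by (simp only:)
    then show ?thesis by (simp only: add_diff_cancel_left scaleR_left_diff_distrib scaleR_one)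
  qed
  then have "cr ((2 * s - 1) *\<^sub>R ?v) u' = cr ((2 * s' - 1) *\<^sub>R ?v') u'" by (simp only:)
  moreover have "cr ?v u' = 0" using uv'(1)
    by (elim disjE) (simp_all only: cr_simps(6,9) minus_zero)
  ultimately have "(2 * s' - 1) * cr ?v' u' = 0" by (simp only: cr_simps(7) mult_zero_right)
  then have s': "s' = 1/2" using d' cr_swap[of ?v' u'] by (simp del: cr_simps)
  \<comment> \<open>The crossing happens at half the height of the tile, so half that height remains
    in either direction.\<close>
  define \<delta> where "\<delta> = cr u' ?v' / 2"
  have \<delta>: "\<delta> > 0" using d' by (simp add: \<delta>_def del: cr_simps)
  have "worm_curve u' P' (t' + \<tau>) = x + (\<tau> / cr u' u) *\<^sub>R u" if \<tau>: "\<bar>\<tau>\<bar> \<le> \<delta>" for \<tau>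
  proof -
    let ?r = "1/2 + \<tau> / cr u' ?v'"
    have "\<bar>\<tau> / cr u' ?v'\<bar> \<le> 1/2" using \<tau> d' by (simp add: \<delta>_def abs_divide divide_le_eq del: cr_simps)
    then have r: "0 \<le> ?r" "?r \<le> 1" by (auto simp only: abs_le_iff)
    have "t' + \<tau> = cr u' (P' n') + ?r * cr u' ?v'" using n'(4) s' d' by (simp add: distrib_right del: cr_simps)
    then have "worm_curve u' P' (t' + \<tau>) = P' n' + (1/2) *\<^sub>R u' + ?r *\<^sub>R ?v'"
      using worm_curve_affine[OF w' r, of n'] by (simp only:)
    also have "\<dots> = x + (\<tau> / cr u' ?v') *\<^sub>R ?v'"
      by (subst n'(1)) (simp only: s' scaleR_left_distrib add.assoc)
    also have "(\<tau> / cr u' ?v') *\<^sub>R ?v' = (\<tau> / cr u' u) *\<^sub>R u"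
      using uv'(2) by (elim disjE) (simp_all only: cr_simps divide_minus_right scaleR_minus_left scaleR_minus_right minus_minus)
    finally show ?thesis .
  qed
  then show "\<exists>\<delta>>0. \<forall>\<tau>. \<bar>\<tau>\<bar> \<le> \<delta> \<longrightarrow>
      worm_curve u' P' (t' + \<tau>) = worm_curve u P t + (\<tau> / cr u' u) *\<^sub>R u"
    using \<delta> unfolding x_def by blast
qed

text \<open>By \<open>worms_cross\<close> the function \<open>?f\<close> equals \<tau> at parameter
  distance \<tau> after any of its zeros, so \<open>increasing_zero_unique\<close> applies: there is
  only one crossing, and the sign of \<open>cr u' u\<close> gives its direction.\<close>

lemma worms_cross_side:
  assumes w: "worm u P" and w': "worm u' P'" and nz: "cr u' u \<noteq> 0"
    and eq: "worm_curve u' P' t0 = worm_curve u P s0"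
  shows "t0 < t \<Longrightarrow> 0 < cr u' u * side u P (worm_curve u' P' t)"
    and "t < t0 \<Longrightarrow> cr u' u * side u P (worm_curve u' P' t) < 0"
proof -
  let ?f = "\<lambda>t. cr u' u * side u P (worm_curve u' P' t)"
  have cont: "continuous_on UNIV ?f" by (intro continuous_intros w w')
  have z: "?f t0 = 0" using eq w by simp
  have zero: "\<exists>\<delta>>0. \<forall>\<tau>. \<bar>\<tau>\<bar> \<le> \<delta> \<longrightarrow> ?f (z + \<tau>) = \<tau>" if "?f z = 0" for z
  proof -
    have "side u P (worm_curve u' P' z) = 0" using that nz by simp
    from worms_cross(2)[OF w w' nz side_zeroD[OF w this]] side_zeroD[OF w this] show ?thesis
      using w nz by (metis (no_types, lifting) add_0 nonzero_mult_div_cancel_left side_add side_worm_curve times_divide_eq_right)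
  qed
  show "t0 < t \<Longrightarrow> 0 < ?f t" "t < t0 \<Longrightarrow> ?f t < 0"
    using increasing_zero_unique[OF cont zero z] by auto
qed

text \<open>The tiles on both sides of an edge are unique, so agreement at one vertex spreads both
  ways; only the numbering may differ.\<close>

lemma worm_determined:
  assumes w: "worm u P" and w': "worm u P'" and eq: "P n = P' m"
  shows "worm_curve u P = worm_curve u P'"
proof -
  have shift: "P (n + k) = P' (m + k)" for k
  proof (induction k rule: int_induct[where k = 0])
    case base then show ?case using eq by simp
  next
    case (step1 i)
    have "P (n + i + 1) - P (n + i) = P' (m + i + 1) - P' (m + i)"
    proof (rule tile_side_unique)
      show "tile (P (n + i)) u (P (n + i + 1) - P (n + i))" using wormD(1)[OF w] .
      show "tile (P (n + i)) u (P' (m + i + 1) - P' (m + i))" unfolding step1(2) using wormD(1)[OF w'] .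
      show "cr u (P (n + i + 1) - P (n + i)) * cr u (P' (m + i + 1) - P' (m + i)) > 0"
        using wormD(2)[OF w, of "n + i"] wormD(2)[OF w', of "m + i"] by (rule mult_pos_pos)
    qed
    then show ?case using step1(2) by (simp add: add.assoc)
  next
    case (step2 i)
    define v where "v = P (n + i) - P (n + i - 1)"
    define v' where "v' = P' (m + i) - P' (m + i - 1)"
    have 1: "tile (P (n + i - 1)) u v" "cr u v > 0" using wormD[OF w, of "n + i - 1"] by (auto simp: v_def)
    have 2: "tile (P' (m + i - 1)) u v'" "cr u v' > 0" using wormD[OF w', of "m + i - 1"] by (auto simp: v'_def)
    have "- v = - v'"
    proof (rule tile_side_unique)
      show "tile (P (n + i)) u (- v)" using 1(1) tile_flip(1)[of "P (n + i - 1)" v u] by (simp add: v_def)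
      show "tile (P (n + i)) u (- v')" unfolding step2(2)
        using 2(1) tile_flip(1)[of "P' (m + i - 1)" v' u] by (simp add: v'_def)
      show "cr u (- v) * cr u (- v') > 0" using 1 2 by simp
    qed
    then show ?case using step2(2) by (simp add: v_def v'_def algebra_simps)
  qed
  show ?thesis
  proof
    fix t
    obtain j where j: "cr u (P j) \<le> t" "t < cr u (P (j + 1))" using worm_bracket[OF w] .
    define k where "k = m + (j - n)"
    have k: "P j = P' k" "P (j + 1) = P' (k + 1)"
      using shift[of "j - n"] shift[of "j - n + 1"] by (auto simp: k_def algebra_simps)
    show "worm_curve u P t = worm_curve u P' t"
      using worm_curve_half_open[OF w j] worm_curve_half_open[OF w', of k t] j k by simp
  qed
qed

text \<open>Each tile meeting \<open>B\<close> lies on only two worms, and none of them crosses the given worm twice.\<close>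

lemma crossing_worm_avoiding_bounded:
  assumes w: "worm u P" and B: "bounded B" and I: "infinite I"
  obtains n P' s where "n \<in> I" "worm (- (P (n + 1) - P n)) P'"
    "worm_curve (- (P (n + 1) - P n)) P' s = worm_curve u P ((cr u (P n) + cr u (P (n + 1))) / 2)"
    "range (worm_curve (- (P (n + 1) - P n)) P') \<inter> B = {}"
proof (rule ccontr)
  assume neg: "\<not> thesis"
  note avoid = that
  define v where "v n = P (n + 1) - P n" for n
  define c where "c n = worm_curve u P ((cr u (P n) + cr u (P (n + 1))) / 2)" for n
  \<comment> \<open>With the edge vector reversed to \<open>- v n\<close>, the crossing worm travels
    along \<open>u\<close> through tile n, from left to right. Its vertex 0 is the corner
    \<open>P n + v n\<close>, and its midline passes through the centre of the tile.\<close>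
  have "\<exists>P' s. worm (- v n) P' \<and> worm_curve (- v n) P' s = c n" for n
  proof -
    have t: "tile (P n) u (v n)" "cr u (v n) > 0" using wormD[OF w] by (auto simp: v_def)
    then have "tile (P n + v n) (- v n) u" using tile_flip(2) tile_swap by blast
    moreover have pos: "cr (- v n) u > 0" using t(2) cr_swap[of "v n" u] by simp
    ultimately obtain P' where P': "worm (- v n) P'" "P' 0 = P n + v n" "P' 1 = P n + v n + u"
      using worm_exists by blast
    have "worm_curve (- v n) P' (cr (- v n) (P' 0) + (1/2) * cr (- v n) (P' (0 + 1) - P' 0)) =
        P' 0 + (1/2) *\<^sub>R (- v n) + (1/2) *\<^sub>R (P' (0 + 1) - P' 0)"
      by (rule worm_curve_affine[OF P'(1)]) auto
    also have "\<dots> = P n + (1/2) *\<^sub>R u + (1/2) *\<^sub>R v n"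
      using P'(2,3) by (simp add: vec_eq_iff field_simps)
    also have "\<dots> = worm_curve u P (cr u (P n) + (1/2) * cr u (P (n + 1) - P n))"
      unfolding v_def by (rule worm_curve_affine[OF w, symmetric]) auto
    also have "cr u (P n) + (1/2) * cr u (P (n + 1) - P n) = (cr u (P n) + cr u (P (n + 1))) / 2"
      by (simp add: field_simps)
    finally show ?thesis using P'(1) unfolding c_def by blast
  qed
  then obtain Q s where Q: "\<And>n. worm (- v n) (Q n)" "\<And>n. worm_curve (- v n) (Q n) (s n) = c n" by metis
  have "\<exists>k. parallelogram_at (Q n k) (- v n) (Q n (k + 1) - Q n k) \<inter> B \<noteq> {}" if "n \<in> I" for n
  proof -
    obtain t where t: "worm_curve (- v n) (Q n) t \<in> B"
      using neg avoid[of n "Q n" "s n"] Q[of n] \<open>n \<in> I\<close> unfolding v_def c_def by blast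
    obtain k where k: "cr (- v n) (Q n k) \<le> t" "t < cr (- v n) (Q n (k + 1))" using worm_bracket[OF Q(1)] .
    let ?d = "Q n (k + 1) - Q n k"
    have d: "cr (- v n) ?d > 0" by (rule wormD(2)[OF Q(1)])
    then have nz: "cr (- v n) ?d \<noteq> 0" by simp
    have "worm_curve (- v n) (Q n) t \<in> parallelogram_at (Q n k) (- v n) ?d"
      unfolding worm_curve_half_open[OF Q(1) k] mem_parallelogram[OF nz] using k d by auto
    then show ?thesis using t by blast
  qed
  then obtain k where k: "\<And>n. n \<in> I \<Longrightarrow> parallelogram_at (Q n (k n)) (- v n) (Q n (k n + 1) - Q n (k n)) \<inter> B \<noteq> {}"
    by metis
  \<comment> \<open>\<open>F n\<close> records a tile of the n-th crossing worm meeting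
    \<open>B\<close>, with its representation. Only finitely many values are possible, so two of
    these worms share edge vector and vertex and hence have the same midline.\<close>
  define F where "F n = (Q n (k n), - v n, Q n (k n + 1) - Q n (k n))" for n
  have "F ` I \<subseteq> {(p, u, v). tile p u v \<and> parallelogram_at p u v \<inter> B \<noteq> {}}"
    using k wormD(1)[OF Q(1)] by (auto simp: F_def)
  then have "finite (F ` I)" using finite_tiles_meeting_bounded[OF B] finite_subset by blast
  then have "\<not> inj_on F I" using I finite_imageD by blast
  then obtain n m where nm: "n \<in> I" "m \<in> I" "n \<noteq> m" "F n = F m" by (auto simp: inj_on_def)
  then have v: "- v n = - v m" and Qnm: "Q n (k n) = Q m (k m)" by (auto simp: F_def)
  have Qm: "worm (- v n) (Q m)" unfolding v by (rule Q(1))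
  have "worm_curve (- v n) (Q n) = worm_curve (- v n) (Q m)" by (rule worm_determined[OF Q(1) Qm Qnm])
  then have m: "worm_curve (- v n) (Q n) (s m) = c m" using Q(2)[of m] v by simp
  have cnm: "c n \<noteq> c m"
  proof -
    have lt: "(cr u (P i) + cr u (P (i + 1))) / 2 < (cr u (P j) + cr u (P (j + 1))) / 2" if "i < j" for i j
      using worm_height_mono[OF w, of "i + 1" j] wormD(2)[OF w, of i] wormD(2)[OF w, of j] that by simp
    have "(cr u (P n) + cr u (P (n + 1))) / 2 \<noteq> (cr u (P m) + cr u (P (m + 1))) / 2"
      using lt[of n m] lt[of m n] nm(3) by (cases "n < m") auto
    then show ?thesis unfolding c_def using cr_worm_curve[OF w] by metis
  qed
  then have "s n \<noteq> s m" using m Q(2)[of n] by auto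
  have nz: "cr (- v n) u \<noteq> 0" using wormD(2)[OF w, of n] cr_swap[of "v n" u] by (simp add: v_def)
  have side0: "side u P (worm_curve (- v n) (Q n) (s m)) = 0" unfolding m by (simp add: c_def w)
  have eq: "worm_curve (- v n) (Q n) (s n) = worm_curve u P ((cr u (P n) + cr u (P (n + 1))) / 2)"
    using Q(2)[of n] by (simp only: c_def)
  \<comment> \<open>The shared worm would pass through the centres of two tiles of the given worm,
    but after one crossing it never returns.\<close>
  show False
  proof (cases "s n < s m")
    case True
    from worms_cross_side(1)[OF w Q(1) nz eq True] side0 show False by simp
  next
    case False
    then have "s m < s n" using \<open>s n \<noteq> s m\<close> by linarith
    from worms_cross_side(2)[OF w Q(1) nz eq this] side0 show False by simp
  qed
qed

end

section \<open>Chains of crossing worms\<close>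

text \<open>(a, b) and (c, d) are unit vectors, and c * b - d * a is the sine of the clockwise angle
  from the first to the second. If x is the cosine of that angle, then 1 - x is at least (1 - x) *
  (1 + x) / 2, hence at least \<epsilon>^2 / 2, and in the lower half-plane a - c is at least 1 -
  x.\<close>

lemma lower_half_circle_decrease:
  fixes a b c d \<epsilon> :: real
  assumes ab: "a\<^sup>2 + b\<^sup>2 = 1" and cd: "c\<^sup>2 + d\<^sup>2 = 1" and neg: "b \<le> 0" "d \<le> 0"
    and cross: "\<epsilon> \<le> c * b - d * a" and \<epsilon>: "\<epsilon> > 0"
  shows "c \<le> a - \<epsilon>\<^sup>2 / 2"
proof -
  have ca: "c \<le> a"
  proof (rule ccontr)
    assume "\<not> c \<le> a"
    then have lt: "a < c" by simp
    have pos: "(- d) * a > c * (- b)" using cross \<epsilon> by simp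
    consider "a \<ge> 0" | "a < 0" "c \<ge> 0" | "c < 0" using lt by linarith
    then show False
    proof cases
      case 1
      then have "a\<^sup>2 \<le> c\<^sup>2" using lt by (simp add: power_mono)
      then have "(- d)\<^sup>2 \<le> (- b)\<^sup>2" using ab cd by simp
      then have "- d \<le> - b" by (rule power2_le_imp_le) (use neg in simp)
      then have "(- d) * a \<le> (- b) * c" using 1 lt neg by (intro mult_mono) auto
      then show ?thesis using pos by (simp add: mult.commute)
    next
      case 2
      then have "(- d) * a \<le> 0" "c * (- b) \<ge> 0" using neg by (simp_all add: mult_nonneg_nonpos mult_nonpos_nonpos mult_nonneg_nonpos2)
      then show ?thesis using pos by linarith
    next
      case 3
      then have "(- c)\<^sup>2 \<le> (- a)\<^sup>2" using lt by (intro power_mono) auto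
      then have "(- b)\<^sup>2 \<le> (- d)\<^sup>2" using ab cd by simp
      then have "- b \<le> - d" by (rule power2_le_imp_le) (use neg in simp)
      then have "(- b) * (- c) \<le> (- d) * (- a)" using 3 lt neg by (intro mult_mono) auto
      then show ?thesis using pos by (simp add: mult.commute)
    qed
  qed
  have abs: "\<bar>a\<bar> \<le> 1" "\<bar>c\<bar> \<le> 1"
  proof -
    have "a\<^sup>2 \<le> 1" "c\<^sup>2 \<le> 1" using ab cd zero_le_power2[of b] zero_le_power2[of d] by linarith+
    then show "\<bar>a\<bar> \<le> 1" "\<bar>c\<bar> \<le> 1" by (simp_all only: abs_square_le_1)
  qed
  define x where "x = a * c + b * d"
  \<comment> \<open>The square of b * d is the product of (1 - a) * (1 + c) and (1 + a) * (1 - c),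
    and the first factor is the smaller one because c \<le> a. The root of the inequality is 1 - x
    \<le> a - c in expanded form.\<close>
  have "((1 - a) * (1 + c))\<^sup>2 \<le> (b * d)\<^sup>2"
  proof -
    have "(b * d)\<^sup>2 = ((1 - a) * (1 + c)) * ((1 + a) * (1 - c))"
    proof -
      have "b\<^sup>2 = 1 - a\<^sup>2" "d\<^sup>2 = 1 - c\<^sup>2" using ab cd by linarith+
      then have "(b * d)\<^sup>2 = (1 - a\<^sup>2) * (1 - c\<^sup>2)" by (simp only: power_mult_distrib)
      then show ?thesis by (simp add: power2_eq_square algebra_simps)
    qed
    moreover have "(1 - a) * (1 + c) \<le> (1 + a) * (1 - c)" using ca by (simp add: algebra_simps)
    moreover have "0 \<le> (1 - a) * (1 + c)" using abs by (intro mult_nonneg_nonneg) auto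
    ultimately show ?thesis by (simp add: power2_eq_square mult_left_mono)
  qed
  moreover have "0 \<le> b * d" using neg by (simp add: mult_nonpos_nonpos)
  ultimately have "(1 - a) * (1 + c) \<le> b * d" by (rule power2_le_imp_le)
  then have 1: "1 - x \<le> a - c" by (simp add: x_def algebra_simps)
  have x2: "x\<^sup>2 + (c * b - d * a)\<^sup>2 = 1"
  proof -
    have "x\<^sup>2 + (c * b - d * a)\<^sup>2 = (a\<^sup>2 + b\<^sup>2) * (c\<^sup>2 + d\<^sup>2)"
      by (simp add: x_def power2_eq_square algebra_simps)
    then show ?thesis using ab cd by simp
  qed
  have "\<epsilon>\<^sup>2 \<le> (c * b - d * a)\<^sup>2" using cross \<epsilon> by (intro power_mono) auto
  then have "\<epsilon>\<^sup>2 \<le> (1 - x) * (1 + x)" using x2 by (simp add: power2_eq_square algebra_simps)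
  moreover have "x\<^sup>2 \<le> 1" using x2 zero_le_power2[of "c * b - d * a"] by linarith
  then have "\<bar>x\<bar> \<le> 1" by (simp only: abs_square_le_1)
  then have "(1 - x) * (1 + x) \<le> (1 - x) * 2" by (intro mult_left_mono) auto
  ultimately show ?thesis using 1 by simp
qed

lemma continuous_constant_sign:
  fixes f :: "real \<Rightarrow> real"
  assumes "continuous_on UNIV f" "\<And>t. f t \<noteq> 0"
  shows "(\<forall>t. f t > 0) \<or> (\<forall>t. f t < 0)"
proof (rule ccontr)
  assume "\<not> ?thesis"
  then obtain a b where ab: "f a > 0" "f b < 0" using assms(2) by (meson linorder_neqE_linordered_idom)
  have c: "continuous_on S f" for S using assms(1) continuous_on_subset by blast
  have "\<exists>x. f x = 0"
  proof (cases "a \<le> b")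
    case True
    then show ?thesis using IVT2'[of f b 0 a] ab c by force
  next
    case False
    then show ?thesis using IVT'[of f b 0 a] ab c by force
  qed
  then show False using assms(2) by blast
qed

section \<open>The link relation on edge vectors and the trapping argument\<close>

context ptiling begin

text \<open>Parallel edge vectors count as linked, so that \<open>u\<close> reaches
  \<open>- u\<close> and any two worms whose midlines meet have linked edges. Images stay finite
  because only finitely many edge lengths occur.\<close>

definition related :: "((real^2) \<times> (real^2)) set" where
  "related = {(u, v). u \<in> edges \<and> v \<in> edges \<and> (cr u v = 0 \<or> (\<exists>p. tile p u v))}"

lemma related_sym: "(u, v) \<in> related \<Longrightarrow> (v, u) \<in> related"
  using tile_swap cr_swap[of v u] by (auto simp: related_def)

lemma related_refl: "u \<in> edges \<Longrightarrow> (u, u) \<in> related" "u \<in> edges \<Longrightarrow> (u, - u) \<in> related"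
  using edges_uminus by (auto simp: related_def)

lemma tile_related: "tile p u v \<Longrightarrow> (u, v) \<in> related" "tile p u v \<Longrightarrow> (u, - v) \<in> related"
proof -
  assume t: "tile p u v"
  have "u \<in> edges" "v \<in> edges" using t tile_swap unfolding edges_def by blast+
  moreover have "tile (p + v) u (- v)" using t by (simp add: tile_flip)
  ultimately show "(u, v) \<in> related" "(u, - v) \<in> related"
    using t edges_uminus by (auto simp: related_def)
qed

lemma related_image_finite: "finite (related `` {u})"
proof (cases "u \<in> edges")
  case True
  then have u0: "u \<noteq> 0" by (rule edges_nonzero)
  let ?A = "\<Union>l\<in>norm ` edges. {(l / norm u) *\<^sub>R u, (- l / norm u) *\<^sub>R u}"
  have "v \<in> ?A" if v: "v \<in> edges" "cr u v = 0" for v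
  proof -
    define k where "k = v \<bullet> u / (u \<bullet> u)"
    have vk: "v = k *\<^sub>R u" using cr_eq_0_parallel[OF v(2) u0] by (simp add: k_def)
    then have "norm v = \<bar>k\<bar> * norm u" by (simp only: norm_scaleR)
    then have "\<bar>k\<bar> = norm v / norm u" using u0 by simp
    then have "k = norm v / norm u \<or> k = - norm v / norm u" by auto
    then have "v \<in> {(norm v / norm u) *\<^sub>R u, (- norm v / norm u) *\<^sub>R u}" using vk by auto
    then show ?thesis using v(1) by blast
  qed
  then have "related `` {u} \<subseteq> ?A \<union> {v. \<exists>p. tile p u v}" by (auto simp: related_def)
  moreover have "finite ?A" by (intro finite_UN_I edge_lengths_finite) auto
  ultimately show ?thesis using tile_finite_image[OF u0] by (meson finite_UnI finite_subset)
next
  case False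
  then have "related `` {u} = {}" by (auto simp: related_def)
  then show ?thesis by simp
qed

lemma related_power_image_finite: "finite ((related ^^ n) `` {u})"
proof (induction n)
  case (Suc n)
  have "(related ^^ Suc n) `` {u} = (\<Union>v\<in>(related ^^ n) `` {u}. related `` {v})" by auto
  then show ?case using Suc related_image_finite by simp
qed simp

lemma related_power_mono:
  assumes "(u, v) \<in> related ^^ n" "u \<in> edges" "n \<le> m"
  shows "(u, v) \<in> related ^^ m"
  using assms(3,1)
proof (induction m rule: dec_induct)
  case (step m)
  then show ?case using relpow_Suc_I2[OF related_refl(1)[OF assms(2)]] by blast
qed

lemma worms_meet_related:
  assumes w: "worm u P" and w': "worm u' P'" and meet: "worm_curve u P t = worm_curve u' P' t'"
  shows "(u, u') \<in> related"
proof (cases "cr u u' = 0")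
  case True
  then show ?thesis using worm_edge w w' by (auto simp: related_def)
next
  case False
  from worms_cross(1)[OF w' w this meet] show ?thesis using tile_related(1) related_sym by blast
qed

text \<open>The region \<open>Q\<close> is bounded by the target worm \<open>(u', P')\<close>, by the part of the worm
  \<open>(u, P)\<close> from height \<open>t0\<close> on, and by a bounded set, and it lies to the right of \<open>(u, P)\<close>.
  A worm entering \<open>Q\<close> far out through \<open>(u, P)\<close> can only escape through the target.\<close>

definition trapped where
  "trapped e u' P' Q u P t0 \<longleftrightarrow> worm u P \<and> open Q \<and>
    (\<exists>B. bounded B \<and> frontier Q \<subseteq> range (worm_curve u' P') \<union> worm_curve u P ` {t0..} \<union> B) \<and>
    (\<forall>x\<in>Q. 0 \<le> side u P x) \<and>
    (\<forall>t>t0. \<exists>\<delta>>0. \<forall>s. 0 < s \<and> s < \<delta> \<longrightarrow> worm_curve u P t + s *\<^sub>R u \<in> Q) \<and>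
    (\<forall>Y. bounded (Q \<inter> {x. cr e x \<le> Y})) \<and>
    (\<forall>Y. \<exists>t>t0. Y < cr e (worm_curve u P t)) \<and>
    cr e u \<le> 0"

text \<open>If the steps eventually stopped rising relative to \<open>e\<close>, the curve would
  stay below its maximum on a compact initial arc. Upward steps are needed for the next turn: a worm
  crossing there has the negative of the step as its edge vector, which points into the lower
  half-plane.\<close>

lemma infinitely_many_upward_steps:
  assumes w: "worm u P" and unb: "\<forall>Y. \<exists>t>t0. Y < cr e (worm_curve u P t)"
  shows "infinite {n. t0 < cr u (P n) \<and> 0 < cr e (P (n + 1) - P n)}" (is "infinite ?I")
proof
  assume fin: "finite ?I"
  obtain k where k: "cr u (P k) \<le> t0" "t0 < cr u (P (k + 1))" using worm_bracket[OF w] .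
  obtain M where M: "\<And>n. n \<in> ?I \<Longrightarrow> n < M"
    using fin by (metis (no_types, lifting) Max_ge le_less_trans less_add_one)
  define N where "N = max M (k + 1)"
  have N: "t0 < cr u (P n)" "cr e (P (n + 1) - P n) \<le> 0" if "n \<ge> N" for n
  proof -
    show "t0 < cr u (P n)" using worm_height_mono[OF w, of "k + 1" n] k that by (simp add: N_def)
    then show "cr e (P (n + 1) - P n) \<le> 0" using M[of n] that by (force simp: N_def)
  qed
  let ?g = "worm_curve u P" and ?T = "cr u (P N)"
  have lin: "linear (\<lambda>x. - cr e x)" by (rule linearI) auto
  have later: "cr e (?g t) \<le> cr e (?g ?T)" if "?T \<le> t" for t
    using worm_curve_mono[OF w lin, of N 0 ?T t] N(2) that by simp
  have "continuous_on {t0..?T} (\<lambda>t. cr e (?g t))" by (intro continuous_intros worm_curve_comp_continuous[OF w])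
  then have "bounded ((\<lambda>t. cr e (?g t)) ` {t0..?T})"
    by (intro compact_imp_bounded compact_continuous_image) auto
  then obtain b where b: "\<And>t. t \<in> {t0..?T} \<Longrightarrow> \<bar>cr e (?g t)\<bar> \<le> b" unfolding bounded_iff by (metis imageI real_norm_def)
  obtain t where t: "t > t0" "b < cr e (?g t)" using unb by blast
  have "cr e (?g t) \<le> b"
  proof (cases "t \<le> ?T")
    case True
    then show ?thesis using b[of t] t by auto
  next
    case False
    then show ?thesis using later[of t] b[of ?T] N(1)[of N] by auto
  qed
  then show False using t by simp
qed

text \<open>One turn of the argument: the crossing worm either meets the target, or becomes the
  upper boundary of a smaller trapping region. In the latter case \<open>cr v u > 0\<close> records
  that the edge has turned clockwise.\<close>

lemma trapped_step:
  assumes tr: "trapped e u' P' Q u P t0" and w': "worm u' P'"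
  shows "\<exists>v. (u, v) \<in> related \<and> ((v, u') \<in> related \<or>
    (\<exists>p. tile p u v) \<and> cr v u > 0 \<and> (\<exists>Q1 P1 t1. trapped e u' P' Q1 v P1 t1))"
proof -
  have w: "worm u P" and opQ: "open Q" and sideQ: "\<And>x. x \<in> Q \<Longrightarrow> 0 \<le> side u P x"
    and adj: "\<And>t. t > t0 \<Longrightarrow> \<exists>\<delta>>0. \<forall>s. 0 < s \<and> s < \<delta> \<longrightarrow> worm_curve u P t + s *\<^sub>R u \<in> Q"
    and bdd: "\<And>Y. bounded (Q \<inter> {x. cr e x \<le> Y})"
    and unb: "\<forall>Y. \<exists>t>t0. Y < cr e (worm_curve u P t)"
    using tr unfolding trapped_def by blast+
  obtain B where B: "bounded B" "frontier Q \<subseteq> range (worm_curve u' P') \<union> worm_curve u P ` {t0..} \<union> B"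
    using tr unfolding trapped_def by blast
  let ?g = "worm_curve u P"
  obtain n P1 s0 where n: "n \<in> {n. t0 < cr u (P n) \<and> 0 < cr e (P (n + 1) - P n)}"
    and P1: "worm (- (P (n + 1) - P n)) P1"
      "worm_curve (- (P (n + 1) - P n)) P1 s0 = ?g ((cr u (P n) + cr u (P (n + 1))) / 2)"
      "range (worm_curve (- (P (n + 1) - P n)) P1) \<inter> B = {}"
    using crossing_worm_avoiding_bounded[OF w B(1) infinitely_many_upward_steps[OF w unb]] .
  define v where "v = - (P (n + 1) - P n)"
  define tc where "tc = (cr u (P n) + cr u (P (n + 1))) / 2"
  let ?b = "worm_curve v P1"
  have w1: "worm v P1" and meet: "?b s0 = ?g tc" and avoid: "range ?b \<inter> B = {}"
    using P1 unfolding v_def tc_def by simp_all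
  have step: "tile (P n) u (- v)" "cr u (- v) > 0" using wormD[OF w, of n] by (simp_all only: v_def minus_minus)
  have tc: "t0 < tc" using n step(2) by (simp add: tc_def v_def)
  have ev: "cr e v < 0" using n by (simp add: v_def)
  have pos: "cr v u > 0" and neg: "cr u v < 0" using step(2) cr_swap[of v u] by simp_all
  have rel: "(u, v) \<in> related" using tile_related(2)[OF step(1)] by simp
  have tile: "\<exists>p. tile p u v" using step(1) tile_flip(1)[of "P n" "- v" u] by auto
  have after: "0 < side u P (?b s)" if "s0 < s" for s
    using worms_cross_side(1)[OF w w1 _ meet that] pos by (simp add: zero_less_mult_iff)
  have before: "side u P (?b s) < 0" if "s < s0" for s
    using worms_cross_side(2)[OF w w1 _ meet that] pos by (simp add: mult_less_0_iff)
  have later: "side v P1 (?g t) < 0" if "tc < t" for t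
    using worms_cross_side(1)[OF w1 w _ meet[symmetric] that] neg by (simp add: zero_less_mult_iff)
  show ?thesis
  proof (cases "range ?b \<inter> range (worm_curve u' P') = {}")
    case False
    then have "(v, u') \<in> related" using worms_meet_related[OF w1 w'] by blast
    then show ?thesis using rel by blast
  next
    case disj: True
    let ?C = "?b ` {s0<..}"
    \<comment> \<open>The ray after the crossing misses all three parts of the frontier: the target
      by \<open>disj\<close>, the old worm because it is crossed only once, and \<open>B\<close> by
      the choice of the new worm. Being connected and containing a point of \<open>Q\<close> just
      after the crossing, it stays in \<open>Q\<close>.\<close>
    have "?C \<subseteq> Q"
    proof -
      have "continuous_on {s0<..} ?b" using worm_curve_continuous[OF w1] continuous_on_subset by blast
      then have conn: "connected ?C" by (rule connected_continuous_image) simp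
      have "x \<notin> range ?g" if "x \<in> ?C" for x using that after side_worm_curve[OF w] by force
      then have fr: "?C \<inter> frontier Q = {}" using B(2) disj avoid by blast
      obtain \<delta> where \<delta>: "\<delta> > 0" "\<And>s. 0 < s \<Longrightarrow> s < \<delta> \<Longrightarrow> ?g tc + s *\<^sub>R u \<in> Q" using adj[OF tc] by blast
      obtain \<eta> where \<eta>: "\<eta> > 0" "\<And>\<tau>. \<bar>\<tau>\<bar> \<le> \<eta> \<Longrightarrow> ?b (s0 + \<tau>) = ?g tc + (\<tau> / cr v u) *\<^sub>R u"
        using worms_cross(2)[OF w w1 _ meet] pos by auto
      define \<tau> where "\<tau> = min \<eta> (\<delta> * cr v u / 2)"
      have \<tau>: "0 < \<tau>" "\<bar>\<tau>\<bar> \<le> \<eta>" "\<tau> \<le> \<delta> * cr v u / 2" using \<delta>(1) \<eta>(1) pos by (auto simp: \<tau>_def)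
      have "\<tau> / cr v u \<le> \<delta> / 2" using \<tau>(3) pos by (simp add: divide_le_eq)
      then have "\<tau> / cr v u < \<delta>" using \<delta>(1) by linarith
      then have "?b (s0 + \<tau>) \<in> Q" unfolding \<eta>(2)[OF \<tau>(2)] using \<delta>(2) \<tau>(1) pos by (meson divide_pos_pos)
      moreover have "?b (s0 + \<tau>) \<in> ?C" using \<tau>(1) by (intro imageI) simp
      ultimately have "?C \<inter> Q \<noteq> {}" by blast
      then show ?thesis using connected_Int_frontier[OF conn] fr by blast
    qed
    then have bQ: "?b s \<in> Q" if "s > s0" for s using that by auto
    \<comment> \<open>\<open>Q1\<close> is the part of \<open>Q\<close> to the right of the new
      worm; by \<open>later\<close> the old worm beyond the crossing lies on its left.\<close>
    define Q1 where "Q1 = Q \<inter> {x. 0 < side v P1 x}"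
    have opQ1: "open Q1" unfolding Q1_def
      by (intro open_Int opQ open_Collect_less side_continuous[OF w1] continuous_intros)
    have cl: "closed {x. 0 \<le> side u P x}" "closed {x. 0 \<le> side v P1 x}"
      by (intro closed_Collect_le side_continuous[OF w1] side_continuous[OF w] continuous_intros)+
    have clQ: "closure Q \<subseteq> {x. 0 \<le> side u P x}"
      by (rule closure_minimal) (use sideQ cl in auto)
    have clQ1: "closure Q1 \<subseteq> {x. 0 \<le> side v P1 x}"
      by (rule closure_minimal) (use cl in \<open>auto simp: Q1_def\<close>)
    \<comment> \<open>Only the arc of the old worm up to the crossing can still bound
      \<open>Q1\<close>; it is compact and is absorbed into the bounded set.\<close>
    define B1 where "B1 = B \<union> ?g ` {t0..tc}"
    have "trapped e u' P' Q1 v P1 s0"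
      unfolding trapped_def
    proof (intro conjI allI ballI impI)
      show "worm v P1" "open Q1" using w1 opQ1 .
      show "cr e v \<le> 0" using ev by simp
      show "\<exists>B. bounded B \<and> frontier Q1 \<subseteq> range (worm_curve u' P') \<union> ?b ` {s0..} \<union> B"
      proof (intro exI[of _ B1] conjI subsetI)
        have "continuous_on {t0..tc} ?g" using worm_curve_continuous[OF w] continuous_on_subset by blast
        then show "bounded B1" unfolding B1_def
          by (intro bounded_Un[THEN iffD2] conjI B(1) compact_imp_bounded compact_continuous_image) auto
        fix x assume x: "x \<in> frontier Q1"
        then have x1: "x \<in> closure Q1" "x \<notin> Q1" using opQ1 by (auto simp: frontier_def interior_open)
        then have xQ: "x \<in> closure Q" "0 \<le> side v P1 x"
          using closure_mono[of Q1 Q] clQ1 by (auto simp: Q1_def)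
        show "x \<in> range (worm_curve u' P') \<union> ?b ` {s0..} \<union> B1"
        proof (cases "side v P1 x = 0")
          case True
          then have "x = ?b (cr v x)" by (rule side_zeroD[OF w1])
          \<comment> \<open>Before the crossing the new worm is strictly to the left of the old one,
            where the closure of \<open>Q\<close> does not reach.\<close>
          moreover have "cr v x \<ge> s0"
          proof (rule ccontr)
            assume "\<not> s0 \<le> cr v x"
            then have "side u P x < 0" using before[of "cr v x"] calculation by simp
            then show False using xQ clQ by force
          qed
          ultimately show ?thesis by blast
        next
          case False
          then have "x \<notin> Q" using x1(2) xQ(2) by (auto simp: Q1_def)
          then have "x \<in> frontier Q" using xQ(1) opQ by (simp add: frontier_def interior_open)
          then consider "x \<in> range (worm_curve u' P')" | t where "t \<ge> t0" "x = ?g t" | "x \<in> B" using B(2) by auto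
          then show ?thesis
          proof cases
            case 2
            then have "t \<le> tc" using later[of t] xQ(2) by force
            then show ?thesis using 2 by (auto simp: B1_def)
          qed (auto simp: B1_def)
        qed
      qed
      show "0 \<le> side v P1 x" if "x \<in> Q1" for x using that by (simp add: Q1_def)
      show "\<exists>\<delta>>0. \<forall>s. 0 < s \<and> s < \<delta> \<longrightarrow> ?b t + s *\<^sub>R v \<in> Q1" if t: "t > s0" for t
      proof -
        have v0: "norm v > 0" using worm_nonzero[OF w1] by simp
        obtain d where d: "d > 0" "ball (?b t) d \<subseteq> Q" using bQ[OF t] opQ by (meson open_contains_ball)
        have "?b t + s *\<^sub>R v \<in> Q1" if s: "0 < s" "s < d / norm v" for s
        proof -
          have "norm (s *\<^sub>R v) < d" using s v0 by (simp add: pos_less_divide_eq)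
          then have "?b t + s *\<^sub>R v \<in> ball (?b t) d" by (simp add: dist_norm)
          then show ?thesis using d(2) s w1 by (auto simp: Q1_def)
        qed
        then show ?thesis using d(1) v0 by (intro exI[of _ "d / norm v"]) simp
      qed
      show "bounded (Q1 \<inter> {x. cr e x \<le> Y})" for Y
        by (rule bounded_subset[OF bdd[of Y]]) (auto simp: Q1_def)
      show "\<exists>t>s0. Y < cr e (?b t)" for Y
      proof (rule ccontr)
        assume "\<not> ?thesis"
        then have "?C \<subseteq> Q \<inter> {x. cr e x \<le> Y}" using bQ by force
        then have "bounded ?C" using bdd bounded_subset by blast
        then obtain M where M: "\<And>t. t > s0 \<Longrightarrow> norm (?b t) \<le> M" unfolding bounded_iff by auto
        \<comment> \<open>The height of \<open>?b t\<close> is \<open>t\<close> itself and is at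
          most \<open>norm v\<close> times its norm, so this \<open>t\<close> is too large for the
          bound \<open>M\<close>.\<close>
        define t where "t = \<bar>s0\<bar> + norm v * \<bar>M\<bar> + 1"
        have ts: "t > s0" "t > norm v * \<bar>M\<bar>" by (auto simp: t_def intro: add_nonneg_pos add_pos_nonneg)
           (smt (verit) abs_ge_self mult_nonneg_nonneg norm_ge_zero abs_ge_zero)+
        have "t = cr v (?b t)" using w1 by simp
        also have "\<dots> \<le> norm v * norm (?b t)" using abs_cr_le[of v "?b t"] by linarith
        also have "\<dots> \<le> norm v * \<bar>M\<bar>" using M[OF ts(1)] by (intro mult_left_mono) auto
        finally show False using ts(2) by simp
      qed
    qed
    then show ?thesis using rel tile pos by blast
  qed
qed

text \<open>The cosine \<open>e \<bullet> u / norm u\<close> falls by \<epsilon>^2 / 2 at each turn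
  and never below -1, which refutes k = 0. So at most k steps occur, each contributing one link, and
  one more link reaches the target.\<close>

lemma trapped_related:
  assumes e: "norm e = 1" and w': "worm u' P'" and \<epsilon>: "\<epsilon> > 0"
    and bound: "\<And>p u v. tile p u v \<Longrightarrow> \<epsilon> * (norm u * norm v) \<le> \<bar>cr u v\<bar>"
    and tr: "trapped e u' P' Q u P t0" and lt: "e \<bullet> u / norm u < - 1 + real k * (\<epsilon>\<^sup>2 / 2)"
  shows "(u, u') \<in> related ^^ Suc k"
  using tr lt
proof (induction k arbitrary: Q u P t0)
  case 0
  have "worm u P" using 0 unfolding trapped_def by blast
  then have u: "norm u > 0" using worm_nonzero by auto
  have "- norm u \<le> e \<bullet> u" using Cauchy_Schwarz_ineq2[of e u] e by simp
  then have "- 1 \<le> e \<bullet> u / norm u" using u by (simp add: le_divide_eq)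
  then show ?case using 0 by simp
next
  case (Suc k)
  obtain v where v: "(u, v) \<in> related" "(v, u') \<in> related \<or>
    (\<exists>p. tile p u v) \<and> cr v u > 0 \<and> (\<exists>Q1 P1 t1. trapped e u' P' Q1 v P1 t1)"
    using trapped_step[OF Suc.prems(1) w'] by blast
  show ?case
  proof (cases "(v, u') \<in> related")
    case True
    then have "(u, u') \<in> related ^^ Suc (Suc 0)" using v(1) by auto
    moreover have "u \<in> edges" using v(1) by (simp add: related_def)
    ultimately show ?thesis by (rule related_power_mono) simp
  next
    case False
    then obtain p Q1 P1 t1 where p: "tile p u v" and pos: "cr v u > 0" and tr1: "trapped e u' P' Q1 v P1 t1"
      using v(2) by blast
    have u0: "norm u > 0" and v0: "norm v > 0" using tile_cr_nonzero[OF p] by auto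
    have low: "cr e u \<le> 0" "cr e v \<le> 0" using Suc.prems(1) tr1 unfolding trapped_def by blast+
    have unit: "(e \<bullet> z / norm z)\<^sup>2 + (cr e z / norm z)\<^sup>2 = 1" if "norm z > 0" for z
    proof -
      have "(e \<bullet> z)\<^sup>2 + (cr e z)\<^sup>2 = (norm z)\<^sup>2" using cr_sq_plus_inner_sq[of e z] e by simp
      then show ?thesis using that by (simp add: power_divide add_divide_distrib[symmetric])
    qed
    have "e \<bullet> v / norm v \<le> e \<bullet> u / norm u - \<epsilon>\<^sup>2 / 2"
    proof (rule lower_half_circle_decrease[OF unit[OF u0] unit[OF v0] _ _ _ \<epsilon>])
      show "cr e u / norm u \<le> 0" "cr e v / norm v \<le> 0" using low u0 v0 by (simp_all add: divide_le_0_iff)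
      have "cr v u = (e \<bullet> v) * cr e u - cr e v * (e \<bullet> u)"
      proof -
        have "(e \<bullet> v) * cr e u - cr e v * (e \<bullet> u) = (norm e)\<^sup>2 * cr v u"
          unfolding power2_norm_eq_inner by (simp add: inner_vec2 cr_def algebra_simps)
        then show ?thesis using e by simp
      qed
      moreover have "\<epsilon> * (norm u * norm v) \<le> cr v u" using bound[OF p] pos cr_swap[of u v] by simp
      ultimately have "\<epsilon> \<le> ((e \<bullet> v) * cr e u - cr e v * (e \<bullet> u)) / (norm u * norm v)"
        using u0 v0 by (simp add: le_divide_eq)
      also have "\<dots> = e \<bullet> v / norm v * (cr e u / norm u) - cr e v / norm v * (e \<bullet> u / norm u)"
        by (simp add: diff_divide_distrib mult.commute)
      finally show "\<epsilon> \<le> e \<bullet> v / norm v * (cr e u / norm u) - cr e v / norm v * (e \<bullet> u / norm u)" .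
    qed
    moreover have "real (Suc k) * (\<epsilon>\<^sup>2 / 2) = \<epsilon>\<^sup>2 / 2 + real k * (\<epsilon>\<^sup>2 / 2)" by (simp add: distrib_right)
    ultimately have "e \<bullet> v / norm v < - 1 + real k * (\<epsilon>\<^sup>2 / 2)" using Suc.prems(2) by linarith
    then have "(v, u') \<in> related ^^ Suc k" by (rule Suc.IH[OF tr1])
    then show ?thesis by (rule relpow_Suc_I2[OF v(1)])
  qed
qed

text \<open>Each step of the worm makes an angle of sine at least \<epsilon> with \<open>u'\<close>.
  Replacing the direction of \<open>u'\<close> by \<open>e\<close> changes the determinant by at
  most \<epsilon> / 2 times the step length, so at least half of the rise survives.\<close>

lemma transverse_worm:
  assumes e: "norm e = 1" and w': "worm u' P'" and \<epsilon>: "\<epsilon> > 0"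
    and bound: "\<And>p u v. tile p u v \<Longrightarrow> \<epsilon> * (norm u * norm v) \<le> \<bar>cr u v\<bar>"
    and close: "norm (u' /\<^sub>R norm u' - e) \<le> \<epsilon> / 2" and "s \<le> t"
  shows "(t - s) / (2 * norm u') \<le> cr e (worm_curve u' P' t) - cr e (worm_curve u' P' s)"
proof -
  have u': "norm u' > 0" using worm_nonzero[OF w'] by simp
  have lin: "linear (cr e)" by (rule linearI) auto
  obtain N where N: "cr u' (P' N) \<le> s" using worm_bracket[OF w'] by metis
  have "1 / (2 * norm u') * cr u' (P' (n + 1) - P' n) \<le> cr e (P' (n + 1) - P' n)" for n
  proof -
    let ?z = "P' (n + 1) - P' n"
    define z where "z = ?z"
    have z: "cr u' z > 0" "\<epsilon> * (norm u' * norm z) \<le> cr u' z"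
      using wormD(2)[OF w', of n] bound[OF wormD(1)[OF w', of n]] unfolding z_def by simp_all
    have "cr (u' /\<^sub>R norm u' - e) z \<le> \<epsilon> / 2 * norm z"
      using abs_cr_le[of "u' /\<^sub>R norm u' - e" z] mult_right_mono[OF close, of "norm z"] by simp
    moreover have "cr (u' /\<^sub>R norm u' - e) z = cr u' z / norm u' - cr e z"
      by (simp add: divide_inverse mult.commute)
    ultimately have 1: "cr u' z / norm u' - \<epsilon> / 2 * norm z \<le> cr e z" by linarith
    have "\<epsilon> * norm z \<le> cr u' z / norm u'" using z(2) u' by (simp add: le_divide_eq algebra_simps)
    then have "\<epsilon> / 2 * norm z \<le> (cr u' z / norm u') / 2" by simp
    then have "(cr u' z / norm u') / 2 \<le> cr e z" using 1 by linarith
    then show ?thesis unfolding z_def[symmetric] by (simp add: mult.commute)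
  qed
  from worm_curve_mono[OF w' lin this N \<open>s \<le> t\<close>] show ?thesis by simp
qed

text \<open>The first trapping region is the part of the gap between the two worms above a line in
  direction \<open>e\<close>. The cosine starts at 1, and the condition on \<open>k\<close> makes k
  drops exceed its whole range.\<close>

lemma related_of_right:
  assumes w: "worm u P" and w': "worm u' P'" and \<epsilon>: "\<epsilon> > 0" "\<epsilon> \<le> 1"
    and bound: "\<And>p u v. tile p u v \<Longrightarrow> \<epsilon> * (norm u * norm v) \<le> \<bar>cr u v\<bar>"
    and close: "norm (u' /\<^sub>R norm u' - u /\<^sub>R norm u) \<le> \<epsilon> / 2"
    and right: "\<And>t. 0 < side u P (worm_curve u' P' t)"
    and k: "2 < real k * (\<epsilon>\<^sup>2 / 2)"
  shows "(u, u') \<in> related ^^ Suc k"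
proof -
  have u0: "norm u > 0" and u'0: "norm u' > 0" using worm_nonzero w w' by auto
  define e where "e = u /\<^sub>R norm u"
  define \<kappa> where "\<kappa> = 1 / (2 * norm u')"
  let ?g = "worm_curve u P" and ?h = "worm_curve u' P'"
  have e: "norm e = 1" using u0 by (simp add: e_def)
  have \<kappa>: "\<kappa> > 0" using u'0 by (simp add: \<kappa>_def)
  have ue: "u = norm u *\<^sub>R e" using u0 by (simp add: e_def)
  have cre: "cr e x = cr u x / norm u" for x by (simp add: e_def divide_inverse mult.commute)
  have split: "norm x \<le> \<bar>e \<bullet> x\<bar> + \<bar>cr e x\<bar>" for x
  proof -
    have "(norm x)\<^sup>2 = (e \<bullet> x)\<^sup>2 + (cr e x)\<^sup>2" using cr_sq_plus_inner_sq[of e x] e by simp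
    also have "\<dots> \<le> (\<bar>e \<bullet> x\<bar> + \<bar>cr e x\<bar>)\<^sup>2" by (simp add: power2_sum)
    finally show ?thesis by (rule power2_le_imp_le) simp
  qed
  have rise: "\<kappa> * (t - s) \<le> cr e (?h t) - cr e (?h s)" if "s \<le> t" for s t
    using transverse_worm[OF e w' \<epsilon>(1) bound close[folded e_def] that] by (simp add: \<kappa>_def)
  have rise2: "\<kappa> * (t - s)\<^sup>2 \<le> (cr e (?h t) - cr e (?h s)) * (t - s)" for s t
  proof (cases "s \<le> t")
    case True
    then show ?thesis using mult_right_mono[OF rise[OF True], of "t - s"] by (simp add: power2_eq_square mult.assoc)
  next
    case False
    then show ?thesis using mult_right_mono[OF rise[of t s], of "s - t"] by (simp add: power2_eq_square algebra_simps)
  qed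
  \<comment> \<open>The directions are unit vectors at distance at most 1/2, since \<epsilon> \<le>
    1.\<close>
  have eu': "e \<bullet> u' > 0"
  proof -
    let ?f = "u' /\<^sub>R norm u'"
    have "(norm (?f - e))\<^sup>2 = 2 - 2 * (e \<bullet> ?f)"
    proof -
      have "?f \<bullet> ?f = 1" "e \<bullet> e = 1" using e u'0 by (simp_all add: dot_square_norm power2_eq_square)
      then show ?thesis unfolding power2_norm_eq_inner inner_diff_left inner_diff_right by (simp add: inner_commute)
    qed
    moreover have "norm (?f - e) \<le> 1/2" using close \<epsilon> unfolding e_def by linarith
    then have "(norm (?f - e))\<^sup>2 \<le> (1/2)\<^sup>2" by (intro power_mono) auto
    ultimately have "e \<bullet> ?f > 0" by (simp add: power2_eq_square)
    then show ?thesis using u'0 by (simp add: zero_less_mult_iff)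
  qed
  \<comment> \<open>Left and right of the target may also be read off along \<open>e\<close>. If
    \<open>a\<close> and \<sigma> had no common sign, \<open>rise2\<close> between the heights
    \<open>r\<close> and \<open>t\<close> would force \<open>q = 0\<close>; then \<open>e\<close>
    and \<open>u'\<close> are parallel, and \<open>eu'\<close> gives the contradiction.\<close>
  have line: "0 < a * side u' P' (?h r + a *\<^sub>R e)" if a: "a \<noteq> 0" for a r
  proof (rule ccontr)
    define x where "x = ?h r + a *\<^sub>R e"
    define \<sigma> where "\<sigma> = side u' P' x"
    define q where "q = cr u' e"
    assume "\<not> ?thesis"
    then have le: "a * \<sigma> \<le> 0" by (simp add: \<sigma>_def x_def)
    define t where "t = cr u' x"
    have t: "t - r = a * q" using w' by (simp add: t_def x_def q_def)
    have x: "x = ?h t + \<sigma> *\<^sub>R u'" unfolding t_def \<sigma>_def by (rule side_decomp[OF w'])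
    then have z: "?h t - ?h r = a *\<^sub>R e - \<sigma> *\<^sub>R u'" by (simp add: x_def algebra_simps)
    have "cr e (?h t) - cr e (?h r) = cr e (?h t - ?h r)" by simp
    also have "\<dots> = \<sigma> * q" unfolding z by (simp add: q_def cr_swap[of e u'])
    finally have "\<kappa> * (a * q)\<^sup>2 \<le> (\<sigma> * q) * (a * q)" using rise2[of t r] t by simp
    also have "\<dots> = (a * \<sigma>) * q\<^sup>2" by (simp add: power2_eq_square)
    also have "\<dots> \<le> 0" using le by (simp add: mult_nonpos_nonneg)
    finally have "(a * q)\<^sup>2 \<le> 0" using \<kappa> by (simp add: mult_le_0_iff)
    then have "q = 0" using a by simp
    then have "a *\<^sub>R e = \<sigma> *\<^sub>R u'" using z t by simp
    then have "e \<bullet> (a *\<^sub>R e) = e \<bullet> (\<sigma> *\<^sub>R u')" by simp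
    then have "a = \<sigma> * (e \<bullet> u')" using e by (simp add: dot_square_norm)
    then have "a * a = (a * \<sigma>) * (e \<bullet> u')" by simp
    also have "\<dots> \<le> 0" using le eu' by (simp add: mult_nonpos_nonneg)
    finally show False using a not_real_square_gt_zero[of a] by linarith
  qed
  \<comment> \<open>The steady rise of the target makes it reach every level of \<open>e\<close>, at
    a parameter controlled by that level.\<close>
  have level: "\<exists>r. cr e (?h r) = y \<and> \<kappa> * \<bar>r\<bar> \<le> \<bar>y - cr e (?h 0)\<bar>" for y
  proof -
    have cont: "continuous_on S (\<lambda>t. cr e (?h t))" for S
      by (intro continuous_intros worm_curve_comp_continuous[OF w'])
    define T where "T = \<bar>y - cr e (?h 0)\<bar> / \<kappa>"
    have T: "T \<ge> 0" "\<kappa> * T = \<bar>y - cr e (?h 0)\<bar>" using \<kappa> by (simp_all add: T_def)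
    have "cr e (?h (- T)) \<le> y" "y \<le> cr e (?h T)"
      using rise[of "- T" 0] rise[of 0 T] T by (auto simp: abs_if split: if_splits)
    then obtain r where r: "- T \<le> r" "r \<le> T" "cr e (?h r) = y"
      using IVT'[of "\<lambda>t. cr e (?h t)" "- T" y T] T cont by auto
    have "\<kappa> * \<bar>r\<bar> \<le> \<kappa> * T" using r \<kappa> by (intro mult_left_mono) auto
    then show ?thesis using r T by auto
  qed
  have horizontal: "x = z + (e \<bullet> (x - z)) *\<^sub>R e" if "cr e x = cr e z" for x z
  proof -
    have "cr e (x - z) = 0" "e \<noteq> 0" using that e by auto
    from cr_eq_0_parallel[OF this] have "x - z = (e \<bullet> (x - z)) *\<^sub>R e"
      using e by (simp add: dot_square_norm inner_commute)
    then show ?thesis by (simp add: algebra_simps)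
  qed
  \<comment> \<open>On each level of \<open>e\<close> the set lies between a point of either worm.
    Over a bounded range of levels these points stay on compact arcs, on the target thanks to
    \<open>level\<close>.\<close>
  have strip: "bounded {x. 0 \<le> side u P x \<and> side u' P' x \<le> 0 \<and> 0 \<le> cr e x \<and> cr e x \<le> Y}" (is "bounded ?S") for Y
  proof -
    define R where "R = (\<bar>Y\<bar> + \<bar>cr e (?h 0)\<bar>) / \<kappa>"
    have "bounded (?h ` {-R..R})" "bounded (?g ` {0..norm u * Y})"
      by (intro compact_imp_bounded compact_continuous_image continuous_on_subset[OF worm_curve_continuous] w w'; simp)+
    then obtain M1 M2 where M: "\<And>r. r \<in> {-R..R} \<Longrightarrow> norm (?h r) \<le> M1"
      "\<And>t. t \<in> {0..norm u * Y} \<Longrightarrow> norm (?g t) \<le> M2"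
      unfolding bounded_iff by (metis image_eqI)
    have "norm x \<le> \<bar>M1\<bar> + \<bar>M2\<bar> + \<bar>Y\<bar>" if x: "x \<in> ?S" for x
    proof -
      obtain r where r: "cr e (?h r) = cr e x" "\<kappa> * \<bar>r\<bar> \<le> \<bar>cr e x - cr e (?h 0)\<bar>" using level by blast
      have "\<bar>cr e x - cr e (?h 0)\<bar> \<le> \<bar>Y\<bar> + \<bar>cr e (?h 0)\<bar>" using x by auto
      then have "\<bar>r\<bar> \<le> R" using r(2) \<kappa> by (simp add: R_def le_divide_eq mult.commute)
      then have hr: "norm (?h r) \<le> M1" using M(1)[of r] by (simp add: abs_le_iff)
      define a where "a = e \<bullet> (x - ?h r)"
      have xa: "x = ?h r + a *\<^sub>R e" unfolding a_def by (rule horizontal) (simp add: r)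
      have "a \<le> 0"
      proof (rule ccontr)
        assume "\<not> a \<le> 0"
        then have "0 < side u' P' x" using line[of a r] xa by (simp add: zero_less_mult_iff)
        then show False using x by simp
      qed
      then have "e \<bullet> x \<le> e \<bullet> ?h r" by (simp add: a_def inner_diff_right)
      also have "\<dots> \<le> M1" using Cauchy_Schwarz_ineq2[of e "?h r"] e hr by simp
      finally have 1: "e \<bullet> x \<le> M1" .
      have "cr u x = norm u * cr e x" using u0 by (simp add: cre)
      then have "cr u x \<in> {0..norm u * Y}" using x u0 by auto
      then have gt: "norm (?g (cr u x)) \<le> M2" by (rule M(2))
      have "e \<bullet> x = e \<bullet> ?g (cr u x) + side u P x * (e \<bullet> u)"
        by (subst side_decomp[OF w, of x]) (simp add: inner_add_right)
      moreover have "e \<bullet> u = norm u" using u0 by (simp add: e_def dot_square_norm power2_eq_square)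
      ultimately have "e \<bullet> ?g (cr u x) \<le> e \<bullet> x" using x u0 by simp
      moreover have "- M2 \<le> e \<bullet> ?g (cr u x)" using Cauchy_Schwarz_ineq2[of e "?g (cr u x)"] e gt by simp
      ultimately have "\<bar>e \<bullet> x\<bar> \<le> \<bar>M1\<bar> + \<bar>M2\<bar>" using 1 by linarith
      moreover have "\<bar>cr e x\<bar> \<le> \<bar>Y\<bar>" using x by auto
      ultimately show ?thesis using split[of x] by linarith
    qed
    then show ?thesis unfolding bounded_iff by blast
  qed
  \<comment> \<open>On the level of \<open>?g t\<close>, the target has a point to the right of it
    along \<open>e\<close>; \<open>line\<close>, read from that point, places \<open>?g t\<close> on
    the left of the target.\<close>
  have left: "side u' P' (?g t) < 0" for t
  proof -
    obtain r where r: "cr e (?h r) = cr e (?g t)" using level by blast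
    then have "cr u (?h r) = t" using u0 w by (simp add: cre)
    then have "?h r = ?g t + side u P (?h r) *\<^sub>R u" using side_decomp[OF w, of "?h r"] by simp
    then have "?g t = ?h r + (- (side u P (?h r) * norm u)) *\<^sub>R e"
      by (metis add_diff_cancel_right' diff_conv_add_uminus scaleR_minus_left scaleR_scaleR ue)
    moreover have "- (side u P (?h r) * norm u) < 0" using right[of r] u0 by simp
    ultimately show ?thesis using line[of "- (side u P (?h r) * norm u)" r]
      by (metis less_irrefl mult_less_cancel_left_neg mult_zero_right)
  qed
  define Q where "Q = {x. 0 < side u P x} \<inter> ({x. side u' P' x < 0} \<inter> {x. 0 < cr e x})"
  have opQ: "open Q" "open ({x. side u' P' x < 0} \<inter> {x. 0 < cr e x})" unfolding Q_def
    by (intro open_Int open_Collect_less side_continuous[OF w] side_continuous[OF w'] continuous_intros)+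
  have "closed ({x. 0 \<le> side u P x} \<inter> ({x. side u' P' x \<le> 0} \<inter> {x. 0 \<le> cr e x}))"
    by (intro closed_Int closed_Collect_le side_continuous[OF w] side_continuous[OF w'] continuous_intros)
  then have clQ: "closure Q \<subseteq> {x. 0 \<le> side u P x} \<inter> ({x. side u' P' x \<le> 0} \<inter> {x. 0 \<le> cr e x})"
    by (rule closure_minimal[rotated]) (auto simp: Q_def)
  have tr: "trapped e u' P' Q u P 0"
    unfolding trapped_def
  proof (intro conjI allI ballI impI)
    show "worm u P" "open Q" using w opQ by auto
    show "0 \<le> side u P x" if "x \<in> Q" for x using that by (simp add: Q_def)
    show "cr e u \<le> 0" by (simp add: e_def)
    show "bounded (Q \<inter> {x. cr e x \<le> Y})" for Y
      by (rule bounded_subset[OF strip[of Y]]) (auto simp: Q_def)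
    show "\<exists>t>0. Y < cr e (?g t)" for Y
    proof (intro exI[of _ "norm u * (\<bar>Y\<bar> + 1)"] conjI)
      show "0 < norm u * (\<bar>Y\<bar> + 1)" using u0 by (intro mult_pos_pos) auto
      show "Y < cr e (?g (norm u * (\<bar>Y\<bar> + 1)))" using u0 w by (simp add: cre)
    qed
    show "\<exists>\<delta>>0. \<forall>s. 0 < s \<and> s < \<delta> \<longrightarrow> ?g t + s *\<^sub>R u \<in> Q" if t: "t > 0" for t
    proof -
      have "?g t \<in> {x. side u' P' x < 0} \<inter> {x. 0 < cr e x}" using left t u0 w by (simp add: cre)
      then obtain d where d: "d > 0" "ball (?g t) d \<subseteq> {x. side u' P' x < 0} \<inter> {x. 0 < cr e x}"
        using opQ(2) by (meson open_contains_ball)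
      have "?g t + s *\<^sub>R u \<in> Q" if s: "0 < s" "s < d / norm u" for s
      proof -
        have "norm (s *\<^sub>R u) < d" using s u0 by (simp add: pos_less_divide_eq)
        then have "?g t + s *\<^sub>R u \<in> ball (?g t) d" by (simp add: dist_norm)
        then show ?thesis using d(2) s w unfolding Q_def by auto
      qed
      then show ?thesis using d(1) u0 by (intro exI[of _ "d / norm u"]) simp
    qed
    show "\<exists>B. bounded B \<and> frontier Q \<subseteq> range ?h \<union> ?g ` {0..} \<union> B"
    proof (intro exI conjI subsetI)
      \<comment> \<open>Level 0 of the strip is the bottom of the region and serves as its bounded
        frontier part.\<close>
      show "bounded {x. 0 \<le> side u P x \<and> side u' P' x \<le> 0 \<and> 0 \<le> cr e x \<and> cr e x \<le> 0}" by (rule strip)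
      fix x assume "x \<in> frontier Q"
      then have x: "x \<in> closure Q" "x \<notin> Q" using opQ by (auto simp: frontier_def interior_open)
      then have xc: "0 \<le> side u P x" "side u' P' x \<le> 0" "0 \<le> cr e x" using clQ by auto
      then consider "side u P x = 0" | "side u' P' x = 0" | "cr e x = 0"
        using x(2) by (force simp: Q_def)
      then show "x \<in> range ?h \<union> ?g ` {0..} \<union>
          {x. 0 \<le> side u P x \<and> side u' P' x \<le> 0 \<and> 0 \<le> cr e x \<and> cr e x \<le> 0}"
      proof cases
        case 1
        then have "x = ?g (cr u x)" by (rule side_zeroD[OF w])
        moreover have "cr u x \<ge> 0" using xc(3) u0 by (simp add: cre zero_le_divide_iff)
        ultimately show ?thesis by blast
      next
        case 2
        then have "x = ?h (cr u' x)" by (rule side_zeroD[OF w'])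
        then show ?thesis by blast
      qed (use xc in simp)
    qed
  qed
  have lt: "e \<bullet> u / norm u < - 1 + real k * (\<epsilon>\<^sup>2 / 2)"
  proof -
    have "e \<bullet> u = norm u" using u0 by (simp add: e_def dot_square_norm power2_eq_square)
    then show ?thesis using u0 k by simp
  qed
  show ?thesis by (rule trapped_related[OF e w' \<epsilon>(1) bound tr lt])
qed

text \<open>The worm is read backwards with each crossed edge starting at its other end
  \<open>P (- k) + u\<close>. This exchanges left and right, so a target on the left becomes a
  target on the right.\<close>

lemma worm_reverse:
  assumes w: "worm u P"
  defines "R \<equiv> \<lambda>k. P (- k) + u"
  shows "worm (- u) R" and "worm_curve (- u) R t = worm_curve u P (- t)"
    and "side (- u) R x = - side u P x"
proof -
  show wR: "worm (- u) R"
    unfolding worm_def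
  proof
    fix k :: int
    let ?m = "- k - 1"
    let ?v = "P (?m + 1) - P ?m"
    have t: "tile (P ?m) u ?v" "cr u ?v > 0" by (rule wormD[OF w])+
    then have "tile (P ?m + ?v + u) (- u) (- ?v)" by (simp only: tile_flip)
    moreover have "P ?m + ?v + u = R k" "R (k + 1) - R k = - ?v" by (simp_all add: R_def)
    ultimately show "tile (R k) (- u) (R (k + 1) - R k) \<and> 0 < cr (- u) (R (k + 1) - R k)"
      using t(2) by (simp only: cr_simps minus_minus) simp
  qed
  show curve: "worm_curve (- u) R t = worm_curve u P (- t)" for t
  proof -
    obtain n where n: "cr u (P n) \<le> - t" "- t < cr u (P (n + 1))" using worm_bracket[OF w] .
    let ?v = "P (n + 1) - P n"
    let ?d = "cr u ?v"
    have d: "?d > 0" by (rule wormD(2)[OF w])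
    have R: "R (- n - 1) = P (n + 1) + u" "R (- n - 1 + 1) = P n + u" by (simp_all add: R_def add.commute)
    have "worm_curve (- u) R t = R (- n - 1) + (1/2) *\<^sub>R (- u) +
        ((t - cr (- u) (R (- n - 1))) / cr (- u) (R (- n - 1 + 1) - R (- n - 1))) *\<^sub>R (R (- n - 1 + 1) - R (- n - 1))"
      by (rule worm_curve_piece[OF wR]) (use n R in auto)
    also have "\<dots> = P (n + 1) + u - (1/2) *\<^sub>R u - ((t + cr u (P (n + 1))) / ?d) *\<^sub>R ?v"
      unfolding R by (simp add: algebra_simps)
    also have "(t + cr u (P (n + 1))) / ?d = 1 - (- t - cr u (P n)) / ?d"
      using d by (simp add: field_simps)
    also have "P (n + 1) + u - (1/2) *\<^sub>R u - (1 - (- t - cr u (P n)) / ?d) *\<^sub>R ?v =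
        P n + (1/2) *\<^sub>R u + ((- t - cr u (P n)) / ?d) *\<^sub>R ?v"
    proof -
      have "P (n + 1) + u - (1/2) *\<^sub>R u - (1 - c) *\<^sub>R ?v = P n + (1/2) *\<^sub>R u + c *\<^sub>R ?v" for c
        by (simp add: vec_eq_iff algebra_simps)
      then show ?thesis .
    qed
    also have "\<dots> = worm_curve u P (- t)" using worm_curve_half_open[OF w n] by simp
    finally show ?thesis .
  qed
  show "side (- u) R x = - side u P x"
    by (simp add: side_def curve)
qed

text \<open>Disjoint worms fall under \<open>related_of_right\<close>, after reversing both if the
  target is on the left; worms that meet are linked directly. What matters is that \<open>N\<close>
  and \<open>d\<close> do not depend on the edges.\<close>

lemma close_edges_related:
  "\<exists>N. \<exists>d>0. \<forall>u\<in>edges. \<forall>u'\<in>edges.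
    norm (u' /\<^sub>R norm u' - u /\<^sub>R norm u) \<le> d \<longrightarrow> (u, u') \<in> related ^^ N"
proof -
  obtain c \<epsilon>0 where \<epsilon>0: "\<epsilon>0 > 0" "\<And>p u v. tile p u v \<Longrightarrow> \<epsilon>0 * (norm u * norm v) \<le> \<bar>cr u v\<bar>"
    using cr_lower_bounds by metis
  \<comment> \<open>The cap at 1 makes the closeness \<epsilon> / 2 small enough to keep the two
    directions at an acute angle.\<close>
  define \<epsilon> where "\<epsilon> = min \<epsilon>0 1"
  have \<epsilon>: "\<epsilon> > 0" "\<epsilon> \<le> 1" using \<epsilon>0 by (auto simp: \<epsilon>_def)
  have bound: "\<epsilon> * (norm u * norm v) \<le> \<bar>cr u v\<bar>" if "tile p u v" for p u v
    using \<epsilon>0(2)[OF that] mult_right_mono[of \<epsilon> \<epsilon>0 "norm u * norm v"] by (simp add: \<epsilon>_def)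
  obtain k where k: "2 < real k * (\<epsilon>\<^sup>2 / 2)"
  proof -
    have "0 < \<epsilon>\<^sup>2 / 2" using \<epsilon>(1) by simp
    from reals_Archimedean3[OF this] show ?thesis using that by blast
  qed
  have worm: "\<exists>P. worm u P" if u: "u \<in> edges" for u
  proof -
    obtain p v where t: "tile p u v" using u unfolding edges_def by blast
    show ?thesis
    proof (cases "cr u v > 0")
      case True
      then show ?thesis using worm_exists[OF t] by metis
    next
      case False
      then have "cr u (- v) > 0" using tile_cr_nonzero[OF t] by simp
      then show ?thesis using worm_exists[of "p + v" u "- v"] t tile_flip(1) by metis
    qed
  qed
  \<comment> \<open>\<open>Suc k\<close> links from the trapping argument, and two more for passing
    from \<open>u\<close> to \<open>- u\<close> and from \<open>- u'\<close> back to
    \<open>u'\<close>; shorter chains are padded by reflexivity.\<close>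
  have "(u, u') \<in> related ^^ (Suc (Suc (Suc k)))"
    if u: "u \<in> edges" "u' \<in> edges" and close: "norm (u' /\<^sub>R norm u' - u /\<^sub>R norm u) \<le> \<epsilon> / 2" for u u'
  proof -
    obtain P P' where w: "worm u P" and w': "worm u' P'" using worm u by blast
    show ?thesis
    proof (cases "\<exists>t. side u P (worm_curve u' P' t) = 0")
      case True
      then have "(u, u') \<in> related" using side_zeroD[OF w] worms_meet_related[OF w w'] by metis
      then have "(u, u') \<in> related ^^ 1" by simp
      then show ?thesis by (rule related_power_mono) (use u in auto)
    next
      case False
      have "continuous_on UNIV (\<lambda>t. side u P (worm_curve u' P' t))"
        by (intro side_continuous[OF w] worm_curve_continuous[OF w'])
      then consider "\<And>t. side u P (worm_curve u' P' t) > 0" | "\<And>t. side u P (worm_curve u' P' t) < 0"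
        using continuous_constant_sign False by blast
      then show ?thesis
      proof cases
        case 1
        have "(u, u') \<in> related ^^ Suc k" by (rule related_of_right[OF w w' \<epsilon> bound close 1 k])
        then show ?thesis by (rule related_power_mono) (use u in auto)
      next
        case 2
        have "(- u, - u') \<in> related ^^ Suc k"
        proof (rule related_of_right[OF worm_reverse(1)[OF w] worm_reverse(1)[OF w'] \<epsilon> bound _ _ k])
          show "norm ((- u') /\<^sub>R norm (- u') - (- u) /\<^sub>R norm (- u)) \<le> \<epsilon> / 2"
            using close by (simp add: norm_minus_commute)
          show "0 < side (- u) (\<lambda>k. P (- k) + u) (worm_curve (- u') (\<lambda>k. P' (- k) + u') t)" for t
            using 2[of "- t"] by (simp only: worm_reverse(2)[OF w'] worm_reverse(3)[OF w] neg_0_less_iff_less)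
        qed
        moreover have "(- u', u') \<in> related" using related_refl(2)[OF u(2)] related_sym by blast
        ultimately have "(- u, u') \<in> related ^^ Suc (Suc k)" by (rule relpow_Suc_I)
        from relpow_Suc_I2[OF related_refl(2)[OF u(1)] this] show ?thesis .
      qed
    qed
  qed
  then show ?thesis using \<epsilon>(1) by (meson half_gt_zero)
qed

text \<open>The unit circle is covered by finitely many balls of radius \<open>d / 2\<close>. Two
  edge directions in one ball are within \<open>d\<close>, so all edges there lie in the finite
  \<open>N\<close>-fold image of any one of them.\<close>

lemma finite_edges: "finite edges"
proof -
  obtain N d where d: "d > 0" and rel: "\<forall>u\<in>edges. \<forall>u'\<in>edges.
    norm (u' /\<^sub>R norm u' - u /\<^sub>R norm u) \<le> d \<longrightarrow> (u, u') \<in> related ^^ N"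
    using close_edges_related by blast
  have "compact (sphere (0::real^2) 1)" by (rule compact_sphere)
  then obtain K where K: "finite K" "sphere (0::real^2) 1 \<subseteq> (\<Union>x\<in>K. ball x (d / 2))"
    using d unfolding compact_eq_totally_bounded by (meson half_gt_zero)
  let ?A = "\<lambda>x. {u \<in> edges. u /\<^sub>R norm u \<in> ball x (d / 2)}"
  have "finite (?A x)" for x
  proof (cases "?A x = {}")
    case False
    then obtain u where u: "u \<in> ?A x" by blast
    have "?A x \<subseteq> (related ^^ N) `` {u}"
    proof
      fix u' assume u': "u' \<in> ?A x"
      have "dist (u' /\<^sub>R norm u') (u /\<^sub>R norm u) \<le> dist x (u' /\<^sub>R norm u') + dist x (u /\<^sub>R norm u)"
        by (rule dist_triangle3)
      also have "\<dots> \<le> d" using u u' by simp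
      finally have "norm (u' /\<^sub>R norm u' - u /\<^sub>R norm u) \<le> d" by (simp add: dist_norm)
      then show "u' \<in> (related ^^ N) `` {u}" using rel u u' by blast
    qed
    then show ?thesis using related_power_image_finite finite_subset by blast
  next
    case True
    show ?thesis unfolding True by simp
  qed
  then have "finite (\<Union>x\<in>K. ?A x)" using K(1) by simp
  moreover have "edges \<subseteq> (\<Union>x\<in>K. ?A x)"
  proof
    fix u assume u: "u \<in> edges"
    then have "u /\<^sub>R norm u \<in> sphere 0 1" using edges_nonzero by simp
    then show "u \<in> (\<Union>x\<in>K. ?A x)" using K(2) u by blast
  qed
  ultimately show ?thesis by (rule rev_finite_subset)
qed

section \<open>From edge vectors to orientations\<close>

lemma finite_orientations: "finite (orientations \<T> C)"
proof -
  \<comment> \<open>The translation class of a tile depends only on its ordered pair of edge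
    vectors, not on its base vertex.\<close>
  have "orientations \<T> C \<subseteq> (\<lambda>(u, v). translation_rel `` {parallelogram_at 0 u v}) ` (edges \<times> edges)"
  proof
    fix X assume "X \<in> orientations \<T> C"
    then obtain P where P: "P \<in> \<T>" "X = translation_rel `` {P}"
      unfolding orientations_def by (auto elim: quotientE)
    obtain p u v where t: "P = parallelogram_at p u v" "tile p u v" using tile_exists[OF P(1)] .
    have shift: "parallelogram_at p u v = (\<lambda>x. p + x) ` parallelogram_at 0 u v"
      unfolding parallelogram_at_def by (auto simp: image_iff add.assoc)
    have "translation_rel `` {(\<lambda>x. p + x) ` S} = translation_rel `` {S}" for S
    proof (intro set_eqI iffI)
      fix T assume "T \<in> translation_rel `` {(\<lambda>x. p + x) ` S}"
      then obtain a where "T = (\<lambda>x. a + x) ` (\<lambda>x. p + x) ` S" by (auto simp: translation_rel_def)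
      then have "T = (\<lambda>x. (a + p) + x) ` S" by (simp add: image_image add.assoc)
      then show "T \<in> translation_rel `` {S}" by (auto simp: translation_rel_def)
    next
      fix T assume "T \<in> translation_rel `` {S}"
      then obtain a where "T = (\<lambda>x. a + x) ` S" by (auto simp: translation_rel_def)
      then have "T = (\<lambda>x. (a - p) + x) ` (\<lambda>x. p + x) ` S" by (simp add: image_image algebra_simps)
      then show "T \<in> translation_rel `` {(\<lambda>x. p + x) ` S}" by (auto simp: translation_rel_def)
    qed
    then have "X = translation_rel `` {parallelogram_at 0 u v}" using P(2) t(1) shift by metis
    moreover have "(u, v) \<in> edges \<times> edges" using t(2) tile_swap unfolding edges_def by blast
    ultimately show "X \<in> (\<lambda>(u, v). translation_rel `` {parallelogram_at 0 u v}) ` (edges \<times> edges)" by force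
  qed
  then show ?thesis using finite_edges by (meson finite_SigmaI finite_imageI finite_subset)
qed

end

theorem theorem2p5:
  fixes \<T> :: "(real^2) set set" and \<alpha> :: real
  assumes "parallelogram_tiling \<T>"
    and "locally_finite_tiling \<T>"
    and "vertex_to_vertex \<T>"
    and "finite (protoset \<T>)"
    and "\<alpha> = min_interior_angle \<T>"
  shows "(\<forall>C \<in> protoset \<T>. finite (orientations \<T> C)) \<and>
         (\<exists>N::nat. \<forall>C \<in> protoset \<T>. card (orientations \<T> C) \<le> N)"
proof -
  interpret ptiling \<T> using assms by unfold_locales
  \<comment> \<open>The common bound is the total over the finite protoset, which dominates each
    summand.\<close>
  have "card (orientations \<T> C) \<le> (\<Sum>D\<in>protoset \<T>. card (orientations \<T> D))" if "C \<in> protoset \<T>" for C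
    using that assms(4) by (intro member_le_sum) auto
  then show ?thesis using finite_orientations by blast
qed

end
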